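(* Let $a\le A<B\le b$, $\alpha,\beta\in(0,1)$, $l\in\mathbb{R}$, and let $L,g:[a,b]\times\mathbb{R}^3\to\mathbb{R}$, $(x,y,u,v)\mapsto L(x,y,u,v)$, $(x,y,u,v)\mapsto g(x,y,u,v)$, have continuous first and second partial derivatives with respect to all their arguments. Put $$\mathcal{J}(y)=\int_A^B L\big(x,y(x),{_a\mathcal{D}_x^\alpha}y(x),{_x\mathcal{D}_b^\beta}y(x)\big)\,dx,\qquad \mathcal{I}(y)=\int_A^B g\big(x,y(x),{_a\mathcal{D}_x^\alpha}y(x),{_x\mathcal{D}_b^\beta}y(x)\big)\,dx$$ for admissible functions $y:[a,b]\to\mathbb{R}$. Let the admissible function $y$ give a local minimum or a local maximum to $\mathcal{J}$ subject to the boundary conditions $y(a)=y_a$, $y(b)=y_b$ and the constraint $\mathcal{I}(y)=l$, and let $L$, $g$ satisfy along $y$ the regularity conditions listed in the context. If $y$ is not an extremal for $\mathcal{I}$, then there exists a constant $\lambda\in\mathbb{R}$ such that, with $F=L-\lambda g$, $$\frac{\partial F}{\partial y}+{_x\mathcal{D}_B^\alpha}\frac{\partial F}{\partial u}+{_A\mathcal{D}_x^\beta}\frac{\partial F}{\partial v}=0\quad\text{for all }x\in[A,B],$$ $${_x\mathcal{D}_B^\alpha}\frac{\partial F}{\partial u}-{_x\mathcal{D}_A^\alpha}\frac{\partial F}{\partial u}=0\quad\text{for all }x\in[a,A],$$ $${_A\mathcal{D}_x^\beta}\frac{\partial F}{\partial v}-{_B\mathcal{D}_x^\beta}\frac{\partial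 F}{\partial v}=0\quad\text{for all }x\in[B,b],$$ where the partial derivatives of $F$ are evaluated at $\big(x,y(x),{_a\mathcal{D}_x^\alpha}y(x),{_x\mathcal{D}_b^\beta}y(x)\big)$.
   Context: For $\gamma\in(0,1)$, real numbers $c<d$ and a continuous function $f$, the left and right Riemann-Liouville fractional derivatives are $${_c\mathcal{D}_x^\gamma}f(x)=\frac{1}{\Gamma(1-\gamma)}\frac{d}{dx}\int_c^x (x-t)^{-\gamma}f(t)\,dt\quad (x>c),\qquad {_x\mathcal{D}_d^\gamma}f(x)=\frac{-1}{\Gamma(1-\gamma)}\frac{d}{dx}\int_x^d (t-x)^{-\gamma}f(t)\,dt\quad (x<d).$$ Saying that such a derivative is continuous on a closed interval means that it exists and extends continuously to the endpoint where the formula is not defined. Equations at endpoints of the intervals $[A,B]$, $[a,A]$, $[B,b]$ are understood as limits from inside the interval; the equation on $[a,A]$ is void if $a=A$, and the one on $[B,b]$ is void if $B=b$. Admissible functions: continuous $y:[a,b]\to\mathbb{R}$ such that ${_a\mathcal{D}_x^\alpha}y$ and ${_x\mathcal{D}_b^\beta}y$ are continuous on $[a,b]$. Each of these two requirements is imposed only if the corresponding derivative is present in the problem (i.e. $L$ or $g$ depends on $u$, respectively on $v$); if a derivative is not present, the corresponding argument is simply omitted. The prescribed boundary values satisfy $y_a=0$ if left fractional derivatives are present and $y_b=0$ if right fractional derivatives are present. Regularity conditions along $y$: $x\mapsto\frac{\partial L}{\partial u}$ and $x\mapsto\frac{\partial g}{\partial u}$, evaluated at $(x,y(x),{_a\mathcal{D}_x^\alpha}y(x),{_x\mathcal{D}_b^\beta}y(x))$,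 have continuous right fractional derivative ${_x\mathcal{D}_b^\alpha}$ on $[a,b]$, and $x\mapsto\frac{\partial L}{\partial v}$, $x\mapsto\frac{\partial g}{\partial v}$, evaluated at the same point, have continuous left fractional derivative ${_a\mathcal{D}_x^\beta}$ on $[a,b]$. Local extremum: fix a norm $\|\cdot\|$ on the linear space of admissible functions. $y$ gives a local minimum (resp. maximum) to $\mathcal{J}$ subject to the boundary conditions and the constraint if $y$ is admissible and satisfies them, and there is $\delta>0$ such that $\mathcal{J}(y)\le\mathcal{J}(y_1)$ (resp. $\mathcal{J}(y)\ge\mathcal{J}(y_1)$) for all admissible $y_1$ satisfying the same boundary conditions and constraint with $\|y-y_1\|<\delta$. Extremal: $y$ is an extremal for $\mathcal{I}$ if $\frac{\partial g}{\partial y}+{_x\mathcal{D}_B^\alpha}\frac{\partial g}{\partial u}+{_A\mathcal{D}_x^\beta}\frac{\partial g}{\partial v}=0$ for all $x\in[A,B]$, with the partial derivatives of $g$ evaluated along $y$. *)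

theory Defs
  imports "HOL-Analysis.Analysis"
begin

section \<open>Riemann-Liouville fractional derivatives\<close>

text \<open>
  The function \<open>f\<close> is regarded as a function on \<open>{c..d}\<close>; only its values there matter.
  The left derivative has base point \<open>c\<close>, the right derivative has base point \<open>d\<close>.
  The ordinary derivative is taken within \<open>{c..d}\<close>, so it is one-sided at the end of the interval
  opposite to the base point and two-sided in the interior.
\<close>

definition left_RL_kernel_int :: "real \<Rightarrow> real \<Rightarrow> (real \<Rightarrow> real) \<Rightarrow> real \<Rightarrow> real" where
  "left_RL_kernel_int \<gamma> c f x = integral {c..x} (\<lambda>t. (x - t) powr (- \<gamma>) * f t)"

definition right_RL_kernel_int :: "real \<Rightarrow> real \<Rightarrow> (real \<Rightarrow> real) \<Rightarrow> real \<Rightarrow> real" where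
  "right_RL_kernel_int \<gamma> d f x = integral {x..d} (\<lambda>t. (t - x) powr (- \<gamma>) * f t)"

definition left_RL_differentiable ::
    "real \<Rightarrow> real \<Rightarrow> real \<Rightarrow> (real \<Rightarrow> real) \<Rightarrow> real \<Rightarrow> bool" where
  "left_RL_differentiable \<gamma> c d f x \<longleftrightarrow>
     left_RL_kernel_int \<gamma> c f differentiable (at x within {c..d})"

definition right_RL_differentiable ::
    "real \<Rightarrow> real \<Rightarrow> real \<Rightarrow> (real \<Rightarrow> real) \<Rightarrow> real \<Rightarrow> bool" where
  "right_RL_differentiable \<gamma> c d f x \<longleftrightarrow>
     right_RL_kernel_int \<gamma> d f differentiable (at x within {c..d})"

definition left_RL :: "real \<Rightarrow> real \<Rightarrow> real \<Rightarrow> (real \<Rightarrow> real) \<Rightarrow> real \<Rightarrow> real" where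
  "left_RL \<gamma> c d f x =
     1 / Gamma (1 - \<gamma>) * vector_derivative (left_RL_kernel_int \<gamma> c f) (at x within {c..d})"

definition right_RL :: "real \<Rightarrow> real \<Rightarrow> real \<Rightarrow> (real \<Rightarrow> real) \<Rightarrow> real \<Rightarrow> real" where
  "right_RL \<gamma> c d f x =
     - 1 / Gamma (1 - \<gamma>) * vector_derivative (right_RL_kernel_int \<gamma> d f) (at x within {c..d})"

text \<open>
  At the base point, where the formula is not defined, the value is the limit. If that limit does
  not exist, the value is unspecified, but then the extended function is not continuous there.
\<close>

definition left_RL_ext :: "real \<Rightarrow> real \<Rightarrow> real \<Rightarrow> (real \<Rightarrow> real) \<Rightarrow> real \<Rightarrow> real" where
  "left_RL_ext \<gamma> c d f x =
     (if x = c then Lim (at_right c) (left_RL \<gamma> c d f) else left_RL \<gamma> c d f x)"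

definition right_RL_ext :: "real \<Rightarrow> real \<Rightarrow> real \<Rightarrow> (real \<Rightarrow> real) \<Rightarrow> real \<Rightarrow> real" where
  "right_RL_ext \<gamma> c d f x =
     (if x = d then Lim (at_left d) (right_RL \<gamma> c d f) else right_RL \<gamma> c d f x)"

definition has_continuous_left_RL :: "real \<Rightarrow> real \<Rightarrow> real \<Rightarrow> (real \<Rightarrow> real) \<Rightarrow> bool" where
  "has_continuous_left_RL \<gamma> c d f \<longleftrightarrow>
     (\<forall>x\<in>{c<..d}. left_RL_differentiable \<gamma> c d f x) \<and>
     continuous_on {c..d} (left_RL_ext \<gamma> c d f)"

definition has_continuous_right_RL :: "real \<Rightarrow> real \<Rightarrow> real \<Rightarrow> (real \<Rightarrow> real) \<Rightarrow> bool" where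
  "has_continuous_right_RL \<gamma> c d f \<longleftrightarrow>
     (\<forall>x\<in>{c..<d}. right_RL_differentiable \<gamma> c d f x) \<and>
     continuous_on {c..d} (right_RL_ext \<gamma> c d f)"

section \<open>Partial derivatives\<close>

text \<open>Partial derivatives relative to a set \<open>X\<close>, one-sided at boundary points of \<open>X\<close> if necessary.\<close>

definition has_partial :: "'a::euclidean_space set \<Rightarrow> ('a \<Rightarrow> real) \<Rightarrow> 'a \<Rightarrow> 'a \<Rightarrow> bool" where
  "has_partial X f e p \<longleftrightarrow>
     (\<lambda>t. f (p + t *\<^sub>R e)) differentiable (at 0 within {t. p + t *\<^sub>R e \<in> X})"

definition partial :: "'a::euclidean_space set \<Rightarrow> ('a \<Rightarrow> real) \<Rightarrow> 'a \<Rightarrow> 'a \<Rightarrow> real" where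
  "partial X f e p =
     vector_derivative (\<lambda>t. f (p + t *\<^sub>R e)) (at 0 within {t. p + t *\<^sub>R e \<in> X})"

definition C1_partials_on :: "'a::euclidean_space set \<Rightarrow> ('a \<Rightarrow> real) \<Rightarrow> bool" where
  "C1_partials_on X f \<longleftrightarrow>
     (\<forall>e\<in>Basis. (\<forall>p\<in>X. has_partial X f e p) \<and> continuous_on X (partial X f e))"

definition C2_partials_on :: "'a::euclidean_space set \<Rightarrow> ('a \<Rightarrow> real) \<Rightarrow> bool" where
  "C2_partials_on X f \<longleftrightarrow>
     C1_partials_on X f \<and> (\<forall>e\<in>Basis. C1_partials_on X (partial X f e))"

text \<open>A Lagrangian takes a quadruple \<open>(x, y, u, v)\<close> with \<open>x\<close> in \<open>{a..b}\<close>.\<close>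

type_synonym point = "real \<times> real \<times> real \<times> real"

definition lagrangian_domain :: "real \<Rightarrow> real \<Rightarrow> point set" where
  "lagrangian_domain a b = {a..b} \<times> UNIV"

definition partial_y :: "real \<Rightarrow> real \<Rightarrow> (point \<Rightarrow> real) \<Rightarrow> point \<Rightarrow> real" where
  "partial_y a b f = partial (lagrangian_domain a b) f (0, 1, 0, 0)"

definition partial_u :: "real \<Rightarrow> real \<Rightarrow> (point \<Rightarrow> real) \<Rightarrow> point \<Rightarrow> real" where
  "partial_u a b f = partial (lagrangian_domain a b) f (0, 0, 1, 0)"

definition partial_v :: "real \<Rightarrow> real \<Rightarrow> (point \<Rightarrow> real) \<Rightarrow> point \<Rightarrow> real" where
  "partial_v a b f = partial (lagrangian_domain a b) f (0, 0, 0, 1)"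

section \<open>The isoperimetric problem\<close>

definition left_present :: "real \<Rightarrow> real \<Rightarrow> (point \<Rightarrow> real) \<Rightarrow> (point \<Rightarrow> real) \<Rightarrow> bool" where
  "left_present a b L g \<longleftrightarrow>
     (\<exists>x\<in>{a..b}. \<exists>y u u' v. L (x, y, u, v) \<noteq> L (x, y, u', v) \<or> g (x, y, u, v) \<noteq> g (x, y, u', v))"

definition right_present :: "real \<Rightarrow> real \<Rightarrow> (point \<Rightarrow> real) \<Rightarrow> (point \<Rightarrow> real) \<Rightarrow> bool" where
  "right_present a b L g \<longleftrightarrow>
     (\<exists>x\<in>{a..b}. \<exists>y u v v'. L (x, y, u, v) \<noteq> L (x, y, u, v') \<or> g (x, y, u, v) \<noteq> g (x, y, u, v'))"

definition admissible ::
    "real \<Rightarrow> real \<Rightarrow> real \<Rightarrow> real \<Rightarrow> (point \<Rightarrow> real) \<Rightarrow> (point \<Rightarrow> real) \<Rightarrow> (real \<Rightarrow> real) set" where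
  "admissible \<alpha> \<beta> a b L g =
     {y. continuous_on {a..b} y \<and>
         (left_present a b L g \<longrightarrow> has_continuous_left_RL \<alpha> a b y) \<and>
         (right_present a b L g \<longrightarrow> has_continuous_right_RL \<beta> a b y)}"

text \<open>
  If a fractional derivative is not present, the corresponding component below may be an
  unspecified number, but neither \<open>L\<close>, \<open>g\<close> nor their partial derivatives depend on it.
\<close>

definition along :: "real \<Rightarrow> real \<Rightarrow> real \<Rightarrow> real \<Rightarrow> (real \<Rightarrow> real) \<Rightarrow> real \<Rightarrow> point" where
  "along \<alpha> \<beta> a b y x = (x, y x, left_RL_ext \<alpha> a b y x, right_RL_ext \<beta> a b y x)"

definition functional ::
    "real \<Rightarrow> real \<Rightarrow> real \<Rightarrow> real \<Rightarrow> real \<Rightarrow> real \<Rightarrow> (point \<Rightarrow> real) \<Rightarrow> (real \<Rightarrow> real) \<Rightarrow> real" where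
  "functional \<alpha> \<beta> a b A B f y = integral {A..B} (\<lambda>x. f (along \<alpha> \<beta> a b y x))"

definition regular_along ::
    "real \<Rightarrow> real \<Rightarrow> real \<Rightarrow> real \<Rightarrow> (point \<Rightarrow> real) \<Rightarrow> (real \<Rightarrow> real) \<Rightarrow> bool" where
  "regular_along \<alpha> \<beta> a b f y \<longleftrightarrow>
     has_continuous_right_RL \<alpha> a b (\<lambda>x. partial_u a b f (along \<alpha> \<beta> a b y x)) \<and>
     has_continuous_left_RL \<beta> a b (\<lambda>x. partial_v a b f (along \<alpha> \<beta> a b y x))"

text \<open>
  Functions on \<open>{a..b}\<close> are represented by total functions, so definiteness refers to \<open>{a..b}\<close>.
  Together with the triangle inequality it makes \<open>N\<close> independent of the values outside \<open>{a..b}\<close>.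
\<close>

definition norm_on :: "real \<Rightarrow> real \<Rightarrow> (real \<Rightarrow> real) set \<Rightarrow> ((real \<Rightarrow> real) \<Rightarrow> real) \<Rightarrow> bool" where
  "norm_on a b V N \<longleftrightarrow>
     (\<forall>f\<in>V. 0 \<le> N f \<and> (N f = 0 \<longleftrightarrow> (\<forall>x\<in>{a..b}. f x = 0))) \<and>
     (\<forall>f\<in>V. \<forall>r. N (\<lambda>x. r * f x) = \<bar>r\<bar> * N f) \<and>
     (\<forall>f\<in>V. \<forall>h\<in>V. N (\<lambda>x. f x + h x) \<le> N f + N h)"

definition feasible ::
    "real \<Rightarrow> real \<Rightarrow> real \<Rightarrow> real \<Rightarrow> real \<Rightarrow> real \<Rightarrow> (point \<Rightarrow> real) \<Rightarrow> (point \<Rightarrow> real) \<Rightarrow>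
     real \<Rightarrow> real \<Rightarrow> real \<Rightarrow> (real \<Rightarrow> real) set" where
  "feasible \<alpha> \<beta> a b A B L g y\<^sub>a y\<^sub>b l =
     {y \<in> admissible \<alpha> \<beta> a b L g. y a = y\<^sub>a \<and> y b = y\<^sub>b \<and> functional \<alpha> \<beta> a b A B g y = l}"

definition local_minimum ::
    "((real \<Rightarrow> real) \<Rightarrow> real) \<Rightarrow> (real \<Rightarrow> real) set \<Rightarrow> ((real \<Rightarrow> real) \<Rightarrow> real) \<Rightarrow> (real \<Rightarrow> real) \<Rightarrow> bool"
where
  "local_minimum N S J y \<longleftrightarrow>
     y \<in> S \<and> (\<exists>\<delta>>0. \<forall>z\<in>S. N (\<lambda>x. y x - z x) < \<delta> \<longrightarrow> J y \<le> J z)"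

definition local_maximum ::
    "((real \<Rightarrow> real) \<Rightarrow> real) \<Rightarrow> (real \<Rightarrow> real) set \<Rightarrow> ((real \<Rightarrow> real) \<Rightarrow> real) \<Rightarrow> (real \<Rightarrow> real) \<Rightarrow> bool"
where
  "local_maximum N S J y \<longleftrightarrow>
     y \<in> S \<and> (\<exists>\<delta>>0. \<forall>z\<in>S. N (\<lambda>x. y x - z x) < \<delta> \<longrightarrow> J y \<ge> J z)"

section \<open>The Euler-Lagrange equations\<close>

text \<open>
  The equation \<open>E = 0\<close> on \<open>{p..q}\<close>, read as a limit from inside at both endpoints. It is void
  for \<open>p = q\<close>, since then \<open>{p<..<q}\<close> is empty and \<open>at p within {p<..<q}\<close> is the trivial filter.
\<close>

definition vanishes_on :: "real \<Rightarrow> real \<Rightarrow> (real \<Rightarrow> real) \<Rightarrow> bool" where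
  "vanishes_on p q E \<longleftrightarrow>
     (\<forall>x\<in>{p<..<q}. E x = 0) \<and>
     (E \<longlongrightarrow> 0) (at p within {p<..<q}) \<and> (E \<longlongrightarrow> 0) (at q within {p<..<q})"

text \<open>
  The fractional derivatives occurring in an equation are required to exist in the interior of
  the interval.
\<close>

definition euler_lagrange_mid ::
    "real \<Rightarrow> real \<Rightarrow> real \<Rightarrow> real \<Rightarrow> real \<Rightarrow> real \<Rightarrow> (point \<Rightarrow> real) \<Rightarrow> (real \<Rightarrow> real) \<Rightarrow> bool" where
  "euler_lagrange_mid \<alpha> \<beta> a b A B f y \<longleftrightarrow>
     (let fy = \<lambda>x. partial_y a b f (along \<alpha> \<beta> a b y x);
          fu = \<lambda>x. partial_u a b f (along \<alpha> \<beta> a b y x);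
          fv = \<lambda>x. partial_v a b f (along \<alpha> \<beta> a b y x)
      in (\<forall>x\<in>{A<..<B}. right_RL_differentiable \<alpha> a B fu x \<and> left_RL_differentiable \<beta> A b fv x) \<and>
         vanishes_on A B (\<lambda>x. fy x + right_RL \<alpha> a B fu x + left_RL \<beta> A b fv x))"

definition euler_lagrange_left ::
    "real \<Rightarrow> real \<Rightarrow> real \<Rightarrow> real \<Rightarrow> real \<Rightarrow> real \<Rightarrow> (point \<Rightarrow> real) \<Rightarrow> (real \<Rightarrow> real) \<Rightarrow> bool" where
  "euler_lagrange_left \<alpha> \<beta> a b A B f y \<longleftrightarrow>
     (let fu = \<lambda>x. partial_u a b f (along \<alpha> \<beta> a b y x)
      in (\<forall>x\<in>{a<..<A}. right_RL_differentiable \<alpha> a B fu x \<and> right_RL_differentiable \<alpha> a A fu x) \<and>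
         vanishes_on a A (\<lambda>x. right_RL \<alpha> a B fu x - right_RL \<alpha> a A fu x))"

definition euler_lagrange_right ::
    "real \<Rightarrow> real \<Rightarrow> real \<Rightarrow> real \<Rightarrow> real \<Rightarrow> real \<Rightarrow> (point \<Rightarrow> real) \<Rightarrow> (real \<Rightarrow> real) \<Rightarrow> bool" where
  "euler_lagrange_right \<alpha> \<beta> a b A B f y \<longleftrightarrow>
     (let fv = \<lambda>x. partial_v a b f (along \<alpha> \<beta> a b y x)
      in (\<forall>x\<in>{B<..<b}. left_RL_differentiable \<beta> A b fv x \<and> left_RL_differentiable \<beta> B b fv x) \<and>
         vanishes_on B b (\<lambda>x. left_RL \<beta> A b fv x - left_RL \<beta> B b fv x))"

definition extremal ::
    "real \<Rightarrow> real \<Rightarrow> real \<Rightarrow> real \<Rightarrow> real \<Rightarrow> real \<Rightarrow> (point \<Rightarrow> real) \<Rightarrow> (real \<Rightarrow> real) \<Rightarrow> bool" where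
  "extremal \<alpha> \<beta> a b A B g y \<longleftrightarrow> euler_lagrange_mid \<alpha> \<beta> a b A B g y"

end

theory Submission
  imports Defs
begin

text \<open>
  Perturb \<open>y\<close> by a combination of two \<open>C\<^sup>1\<close> functions \<open>\<eta>\<^sub>1\<close>, \<open>\<eta>\<^sub>2\<close> that vanish outside
  the open interval from \<open>a\<close> to \<open>b\<close>. If the first variations of the two functionals in these
  directions had a nonzero determinant, then the pair of functionals would be an open map at \<open>y\<close>,
  against the extremality of \<open>y\<close>. Since \<open>y\<close> is not an extremal, some \<open>\<eta>\<^sub>2\<close> supported between
  \<open>A\<close> and \<open>B\<close> has nonzero first variation for the constraint, and this yields the multiplier: the
  first variation of \<open>F\<close> vanishes in all directions. By Fubini's theorem it has the form
  \<open>\<integral> \<eta>' Q\<close> with \<open>Q\<close> built from the kernel integrals of the partial derivatives of \<open>F\<close>, so \<open>Q\<close> is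
  constant on each of the three intervals by the du Bois-Reymond lemma, and the three equations say
  that \<open>Q' = 0\<close> there. They need no discussion at the endpoints, because the left-hand sides vanish
  identically inside.
\<close>

section \<open>The Abel kernel\<close>

text \<open>The obstacle is that the equations use the bases \<open>A\<close> and \<open>B\<close>,
  while regularity is given for the bases \<open>a\<close> and \<open>b\<close>. Splitting a kernel
  integral at the new base leaves a remainder that is smooth strictly beyond that base, but whose
  derivative is in general unbounded near it. Shifting the fractional derivatives from \<eta> onto
  the partial derivatives of \<open>F\<close> would require control of these derivatives up to
  \<open>A\<close> and \<open>B\<close>. Testing against the derivative of \<eta> avoids this: only
  undifferentiated kernel integrals appear under the integral sign, and they are differentiated
  afterwards, at interior points of the three intervals.

  The test functions vanish at \<open>a\<close> and \<open>b\<close> together with their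
  derivatives. Hence their fractional derivatives are Abel integrals of a continuous function, and
  the exchange of integrals concerns absolutely integrable kernels.

  The norm is arbitrary, so nothing can be said about neighbourhoods in the admissible space itself.
  The perturbations, however, fill only a plane of parameters, and there the distance to
  \<open>y\<close> is bounded by a multiple of the Euclidean norm.\<close>

text \<open>The substitution \<open>r = (x - t) powr (1 - \<gamma>)\<close> removes the singularity of the Abel kernel.\<close>

lemma abel_substitution:
  fixes f :: "real \<Rightarrow> real"
  assumes \<gamma>: "0 < \<gamma>" "\<gamma> < 1" and cx: "c \<le> x" and f: "continuous_on {c..x} f"
  shows "((\<lambda>t. (x - t) powr (-\<gamma>) * f t) has_integral
           1 / (1 - \<gamma>) * integral {0..(x - c) powr (1 - \<gamma>)} (\<lambda>r. f (x - r powr (1 / (1 - \<gamma>))))) {c..x}"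
proof -
  let ?p = "1 / (1 - \<gamma>)"
  let ?F = "\<lambda>r. f (x - r powr ?p)"
  let ?g = "\<lambda>t. (x - t) powr (1 - \<gamma>)"
  let ?M = "(x - c) powr (1 - \<gamma>)"
  have inv: "(s powr (1 - \<gamma>)) powr ?p = s" if "0 \<le> s" for s
    using that \<gamma> by (simp add: powr_powr)
  have range: "x - r powr ?p \<in> {c..x}" if "r \<in> {0..?M}" for r
  proof -
    have "r powr ?p \<le> ?M powr ?p"
      using that \<gamma> by (intro powr_mono2) auto
    then show ?thesis using inv[of "x - c"] cx by auto
  qed
  have "continuous_on {0..?M} ?F"
    using \<gamma> range by (intro continuous_on_compose2[OF f] continuous_intros continuous_on_powr') auto
  moreover have "continuous_on {c..x} ?g"
    using \<gamma> by (intro continuous_intros continuous_on_powr') auto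
  moreover have "?g ` {c..x} \<subseteq> {0..?M}"
    using \<gamma> by (auto intro!: powr_mono2)
  moreover have "(?g has_real_derivative (- (1 - \<gamma>) * (x - t) powr (-\<gamma>))) (at t within {c..x})"
    if "t \<in> {c..x} - {x}" for t
    using that \<gamma> by (auto intro!: derivative_eq_intros simp: algebra_simps)
  \<comment> \<open>The point \<open>x\<close>, where \<open>?g\<close> may have infinite slope, is
    the exceptional set. As \<open>?g\<close> is decreasing, the first integral on the right has an
    empty range, or a single point if \<open>x = c\<close>.\<close>
  ultimately have "((\<lambda>t. (- (1 - \<gamma>) * (x - t) powr (-\<gamma>)) *\<^sub>R ?F (?g t)) has_integral
      (integral {?g c..?g x} ?F - integral {?g x..?g c} ?F)) {c..x}"
    using cx by (intro has_integral_substitution_general[where s = "{x}"]) auto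
  moreover have "integral {?g c..?g x} ?F = 0"
    by (cases "x = c") auto
  ultimately have "((\<lambda>t. (- (1 - \<gamma>) * (x - t) powr (-\<gamma>)) * ?F (?g t)) has_integral
      (- integral {0..?M} ?F)) {c..x}"
    by simp
  then have "((\<lambda>t. (- ?p) * ((- (1 - \<gamma>) * (x - t) powr (-\<gamma>)) * ?F (?g t))) has_integral
      ((- ?p) * (- integral {0..?M} ?F))) {c..x}"
    by (rule has_integral_mult_right)
  then show ?thesis
  proof (rule has_integral_eq_rhs[OF has_integral_eq, rotated])
    fix t assume "t \<in> {c..x}"
    then have "x - ?g t powr ?p = t"
      using inv[of "x - t"] by simp
    then show "(- ?p) * ((- (1 - \<gamma>) * (x - t) powr (-\<gamma>)) * ?F (?g t)) = (x - t) powr (-\<gamma>) * f t"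
      using \<gamma> by (simp add: divide_simps) (simp add: algebra_simps)
  qed auto
qed

lemma left_RL_kernel_integrable:
  fixes f :: "real \<Rightarrow> real"
  assumes "0 < \<gamma>" "\<gamma> < 1" "c \<le> x" "continuous_on {c..x} f"
  shows "(\<lambda>t. (x - t) powr (-\<gamma>) * f t) integrable_on {c..x}"
  using abel_substitution[OF assms] by blast

text \<open>After the substitution the upper limit still depends on \<open>x\<close>. As
  \<open>f\<close> vanishes left of \<open>c\<close>, it can be raised to a limit common to all
  \<open>x\<close> in \<open>{c..d}\<close>; then \<open>x\<close> occurs in the integrand only, and
  theorems on parameter integrals apply.\<close>

lemma left_RL_kernel_int_extended:
  assumes \<gamma>: "0 < \<gamma>" "\<gamma> < 1" and f: "continuous_on UNIV f" and zero: "\<And>t. t \<le> c \<Longrightarrow> f t = 0"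
    and x: "x \<in> {c..d}"
  shows "left_RL_kernel_int \<gamma> c f x =
    1 / (1 - \<gamma>) * integral {0..(d - c) powr (1 - \<gamma>)} (\<lambda>r. f (x - r powr (1 / (1 - \<gamma>))))"
proof -
  let ?p = "1 / (1 - \<gamma>)"
  let ?F = "\<lambda>r. f (x - r powr ?p)"
  let ?M = "(d - c) powr (1 - \<gamma>)" and ?m = "(x - c) powr (1 - \<gamma>)"
  have "continuous_on {0..?M} ?F"
    using \<gamma> by (intro continuous_on_compose2[OF f] continuous_intros continuous_on_powr') auto
  moreover have mM: "?m \<le> ?M" using x \<gamma> by (intro powr_mono2) auto
  ultimately have "integral {0..?M} ?F = integral {0..?m} ?F + integral {?m..?M} ?F"
    by (intro Henstock_Kurzweil_Integration.integral_combine[symmetric] integrable_continuous_real) auto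
  moreover have "integral {?m..?M} ?F = integral {?m..?M} (\<lambda>r. 0)"
  proof (rule integral_cong)
    fix r assume "r \<in> {?m..?M}"
    then have "?m powr ?p \<le> r powr ?p" using \<gamma> by (intro powr_mono2) auto
    moreover have "?m powr ?p = x - c" using x \<gamma> by (simp add: powr_powr)
    ultimately show "?F r = 0" by (intro zero) auto
  qed
  moreover have "left_RL_kernel_int \<gamma> c f x = 1 / (1 - \<gamma>) * integral {0..?m} ?F"
    unfolding left_RL_kernel_int_def
    using x continuous_on_subset[OF f] by (intro integral_unique abel_substitution \<gamma>) auto
  ultimately show ?thesis by simp
qed

lemma continuous_on_left_RL_kernel_int:
  assumes \<gamma>: "0 < \<gamma>" "\<gamma> < 1" and f: "continuous_on UNIV f" and zero: "\<And>t. t \<le> c \<Longrightarrow> f t = 0"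
  shows "continuous_on {c..d} (left_RL_kernel_int \<gamma> c f)"
proof -
  let ?p = "1 / (1 - \<gamma>)" and ?M = "(d - c) powr (1 - \<gamma>)"
  have "continuous_on ({c..d} \<times> {0..?M}) (\<lambda>z. f (fst z - snd z powr ?p))"
    using \<gamma> by (intro continuous_on_compose2[OF f] continuous_intros continuous_on_powr') auto
  then have "continuous_on {c..d} (\<lambda>x. integral (cbox 0 ?M) (\<lambda>r. f (x - r powr ?p)))"
    by (intro integral_continuous_on_param) (simp add: case_prod_unfold)
  then have "continuous_on {c..d} (\<lambda>x. ?p * integral {0..?M} (\<lambda>r. f (x - r powr ?p)))"
    by (intro continuous_intros) simp
  then show ?thesis
    by (rule continuous_on_cong[THEN iffD1, rotated -1]) (auto simp: left_RL_kernel_int_extended[OF \<gamma> f zero, where d=d])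
qed

text \<open>For functions that vanish left of \<open>c\<close>, the Riemann-Liouville and Caputo derivatives agree.\<close>

lemma left_RL_kernel_int_has_derivative:
  assumes \<gamma>: "0 < \<gamma>" "\<gamma> < 1" and \<eta>: "\<And>t. (\<eta> has_real_derivative \<phi> t) (at t)"
    and \<phi>: "continuous_on UNIV \<phi>" and zero: "\<And>t. t \<le> c \<Longrightarrow> \<eta> t = 0" "\<And>t. t \<le> c \<Longrightarrow> \<phi> t = 0"
    and x: "x \<in> {c..d}"
  shows "(left_RL_kernel_int \<gamma> c \<eta> has_real_derivative left_RL_kernel_int \<gamma> c \<phi> x) (at x within {c..d})"
proof -
  let ?p = "1 / (1 - \<gamma>)" and ?M = "(d - c) powr (1 - \<gamma>)"
  have cont: "continuous_on UNIV \<eta>"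
    using \<eta> by (intro DERIV_continuous_on) auto
  have "((\<lambda>x. integral (cbox 0 ?M) (\<lambda>r. \<eta> (x - r powr ?p))) has_field_derivative
      integral (cbox 0 ?M) (\<lambda>r. \<phi> (x - r powr ?p))) (at x within {c..d})"
  proof (rule leibniz_rule_field_derivative)
    show "continuous_on ({c..d} \<times> cbox 0 ?M) (\<lambda>(x, r). \<phi> (x - r powr ?p))"
      unfolding case_prod_unfold
      using \<gamma> by (intro continuous_on_compose2[OF \<phi>] continuous_intros continuous_on_powr') auto
    show "(\<lambda>r. \<eta> (x - r powr ?p)) integrable_on cbox 0 ?M" for x
      using \<gamma> by (intro integrable_continuous continuous_on_compose2[OF cont] continuous_intros continuous_on_powr') auto
    show "((\<lambda>x. \<eta> (x - r powr ?p)) has_field_derivative \<phi> (x - r powr ?p)) (at x within {c..d})" for x r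
      by (rule DERIV_chain2[OF \<eta>, of _ 1, simplified]) (auto intro!: derivative_eq_intros)
  qed (use x in auto)
  then have "((\<lambda>x. ?p * integral {0..?M} (\<lambda>r. \<eta> (x - r powr ?p))) has_real_derivative
      ?p * integral {0..?M} (\<lambda>r. \<phi> (x - r powr ?p))) (at x within {c..d})"
    by (intro DERIV_cmult) simp
  then show ?thesis
    using x left_RL_kernel_int_extended[OF \<gamma> \<phi> zero(2) x]
    by (subst has_field_derivative_cong_ev[OF refl, where g = "\<lambda>x. ?p * integral {0..?M} (\<lambda>r. \<eta> (x - r powr ?p))"])
      (auto simp: left_RL_kernel_int_extended[OF \<gamma> cont zero(1), where d=d] eventually_at_filter)
qed

text \<open>The map from \<open>t\<close> to \<open>-t\<close> exchanges the two kinds of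
  derivative. Facts about right derivatives are obtained through it from those about left
  derivatives.\<close>

lemma right_RL_kernel_int_reflect:
  "right_RL_kernel_int \<gamma> d f x = left_RL_kernel_int \<gamma> (-d) (\<lambda>t. f (-t)) (-x)"
  unfolding right_RL_kernel_int_def left_RL_kernel_int_def
  using Henstock_Kurzweil_Integration.integral_reflect_real[of d x "\<lambda>t. (t - x) powr (-\<gamma>) * f t"]
  by (simp add: minus_diff_commute)

section \<open>Linearity and reflection of Riemann-Liouville derivatives\<close>

lemma left_RL_differentiable_iff:
  "left_RL_differentiable \<gamma> c d f x \<longleftrightarrow>
    (\<exists>D. (left_RL_kernel_int \<gamma> c f has_real_derivative D) (at x within {c..d}))"
  unfolding left_RL_differentiable_def by (rule real_differentiable_def)

lemma right_RL_differentiable_iff: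
  "right_RL_differentiable \<gamma> c d f x \<longleftrightarrow>
    (\<exists>D. (right_RL_kernel_int \<gamma> d f has_real_derivative D) (at x within {c..d}))"
  unfolding right_RL_differentiable_def by (rule real_differentiable_def)

lemma left_RL_eqI:
  assumes "c < d" "x \<in> {c..d}" "(left_RL_kernel_int \<gamma> c f has_real_derivative D) (at x within {c..d})"
  shows "left_RL \<gamma> c d f x = 1 / Gamma (1 - \<gamma>) * D"
  using assms unfolding left_RL_def
  by (simp add: vector_derivative_within_closed_interval has_real_derivative_iff_has_vector_derivative)

lemma right_RL_eqI:
  assumes "c < d" "x \<in> {c..d}" "(right_RL_kernel_int \<gamma> d f has_real_derivative D) (at x within {c..d})"
  shows "right_RL \<gamma> c d f x = - 1 / Gamma (1 - \<gamma>) * D"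
  using assms unfolding right_RL_def
  by (simp add: vector_derivative_within_closed_interval has_real_derivative_iff_has_vector_derivative)

text \<open>The value at the base point is a limit of the others, so continuity of \<open>h\<close>
  forces it to be \<open>h c\<close>; only points to the right of \<open>c\<close> have to be
  computed.\<close>

lemma left_RL_ext_eqI:
  assumes cd: "c < d" and eq: "\<And>x. x \<in> {c<..d} \<Longrightarrow> left_RL \<gamma> c d f x = h x"
    and h: "continuous_on {c..d} h" and x: "x \<in> {c..d}"
  shows "left_RL_ext \<gamma> c d f x = h x"
proof (cases "x = c")
  case True
  have "(h \<longlongrightarrow> h c) (at_right c)"
    using h cd at_within_Icc_at_right[OF cd] by (metis atLeastAtMost_iff continuous_on_def less_imp_le order_refl)
  moreover have "\<forall>\<^sub>F x in at_right c. h x = left_RL \<gamma> c d f x"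
    using eq cd by (auto simp: eventually_at_right)
  ultimately have "(left_RL \<gamma> c d f \<longlongrightarrow> h c) (at_right c)"
    by (rule Lim_transform_eventually)
  then show ?thesis
    using True by (simp add: left_RL_ext_def tendsto_Lim)
next
  case False
  then show ?thesis using eq x by (simp add: left_RL_ext_def)
qed

lemma left_RL_kernel_int_add_scaled:
  assumes "0 < \<gamma>" "\<gamma> < 1" "continuous_on {c..x} f" "continuous_on {c..x} h"
  shows "left_RL_kernel_int \<gamma> c (\<lambda>t. f t + r * h t) x =
    left_RL_kernel_int \<gamma> c f x + r * left_RL_kernel_int \<gamma> c h x"
proof (cases "c \<le> x")
  case True
  have "left_RL_kernel_int \<gamma> c (\<lambda>t. f t + r * h t) x =
      integral {c..x} (\<lambda>t. (x - t) powr (-\<gamma>) * f t + r * ((x - t) powr (-\<gamma>) * h t))"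
    unfolding left_RL_kernel_int_def by (simp add: algebra_simps)
  also have "\<dots> = left_RL_kernel_int \<gamma> c f x + r * left_RL_kernel_int \<gamma> c h x"
    unfolding left_RL_kernel_int_def
    using left_RL_kernel_integrable[OF assms(1,2) True] assms(3,4)
    by (subst Henstock_Kurzweil_Integration.integral_add) (auto intro!: integrable_on_mult_right)
  finally show ?thesis .
qed (simp add: left_RL_kernel_int_def)

lemma left_RL_kernel_int_add_scaled_derivative:
  assumes \<gamma>: "0 < \<gamma>" "\<gamma> < 1" and cont: "continuous_on {c..d} f" "continuous_on {c..d} h"
    and x: "x \<in> {c..d}"
    and D: "(left_RL_kernel_int \<gamma> c f has_real_derivative D) (at x within {c..d})"
    and E: "(left_RL_kernel_int \<gamma> c h has_real_derivative E) (at x within {c..d})"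
  shows "(left_RL_kernel_int \<gamma> c (\<lambda>t. f t + r * h t) has_real_derivative D + r * E) (at x within {c..d})"
proof -
  have "left_RL_kernel_int \<gamma> c (\<lambda>t. f t + r * h t) z =
    left_RL_kernel_int \<gamma> c f z + r * left_RL_kernel_int \<gamma> c h z" if "z \<in> {c..d}" for z
    using that by (intro left_RL_kernel_int_add_scaled \<gamma> continuous_on_subset[OF cont(1)] continuous_on_subset[OF cont(2)]) auto
  with x show ?thesis
    by (subst has_field_derivative_cong_ev[OF refl, where g = "\<lambda>z. left_RL_kernel_int \<gamma> c f z + r * left_RL_kernel_int \<gamma> c h z"])
      (auto simp: eventually_at_filter intro!: DERIV_add DERIV_cmult D E)
qed

text \<open>Linearity survives the extension to the base point. This keeps perturbations of an
  admissible function admissible, and makes their fractional derivatives affine in the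
  parameter.\<close>

lemma continuous_left_RL_add_scaled:
  assumes cd: "c < d" and \<gamma>: "0 < \<gamma>" "\<gamma> < 1"
    and cont: "continuous_on {c..d} f" "continuous_on {c..d} h"
    and f: "has_continuous_left_RL \<gamma> c d f" and h: "has_continuous_left_RL \<gamma> c d h"
  shows has_continuous_left_RL_add_scaled: "has_continuous_left_RL \<gamma> c d (\<lambda>x. f x + r * h x)"
    and left_RL_ext_add_scaled: "x \<in> {c..d} \<Longrightarrow>
      left_RL_ext \<gamma> c d (\<lambda>x. f x + r * h x) x = left_RL_ext \<gamma> c d f x + r * left_RL_ext \<gamma> c d h x"
proof -
  let ?h = "\<lambda>x. left_RL_ext \<gamma> c d f x + r * left_RL_ext \<gamma> c d h x"
  have *: "left_RL_differentiable \<gamma> c d (\<lambda>x. f x + r * h x) x \<and>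
      left_RL \<gamma> c d (\<lambda>x. f x + r * h x) x = ?h x" if x: "x \<in> {c<..d}" for x
  proof -
    obtain D E where DE: "(left_RL_kernel_int \<gamma> c f has_real_derivative D) (at x within {c..d})"
        "(left_RL_kernel_int \<gamma> c h has_real_derivative E) (at x within {c..d})"
      using f h x unfolding has_continuous_left_RL_def left_RL_differentiable_iff by blast
    have x': "x \<in> {c..d}" using x by auto
    note D = left_RL_kernel_int_add_scaled_derivative[OF \<gamma> cont x' DE, of r]
    from left_RL_eqI[OF cd x' D] left_RL_eqI[OF cd x' DE(1)] left_RL_eqI[OF cd x' DE(2)] D x
    show ?thesis
      by (auto simp: left_RL_ext_def left_RL_differentiable_iff algebra_simps add_divide_distrib)
  qed
  have h': "continuous_on {c..d} ?h"
    using f h unfolding has_continuous_left_RL_def by (intro continuous_intros) auto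
  show ext: "x \<in> {c..d} \<Longrightarrow> left_RL_ext \<gamma> c d (\<lambda>x. f x + r * h x) x = ?h x" for x
    using left_RL_ext_eqI[OF cd _ h'] * by blast
  show "has_continuous_left_RL \<gamma> c d (\<lambda>x. f x + r * h x)"
    unfolding has_continuous_left_RL_def
    using * continuous_on_cong[THEN iffD2, OF refl ext h'] by blast
qed

lemma has_real_derivative_reflect:
  "((\<lambda>x. f (- x)) has_real_derivative D) (at x within {c..d}) \<longleftrightarrow>
   (f has_real_derivative - D) (at (- x) within {-d..-c})" for f :: "real \<Rightarrow> real"
proof -
  have 1: "((\<lambda>x. f (- x)) has_real_derivative - D) (at x within {c..d})"
    if "(f has_real_derivative D) (at (- x) within {-d..-c})" for f D x c d
    using DERIV_image_chain[of f D "uminus" x "{c..d}" "-1"] that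
    by (auto simp: o_def image_uminus_atLeastAtMost DERIV_minus[OF DERIV_ident])
  show ?thesis
    using 1[of f "-D" x d c] 1[of "\<lambda>x. f (-x)" D "-x" "-c" "-d"] by auto
qed

lemma right_RL_kernel_int_reflect':
  "right_RL_kernel_int \<gamma> d f = (\<lambda>x. left_RL_kernel_int \<gamma> (-d) (\<lambda>t. f (-t)) (-x))"
  by (rule ext) (rule right_RL_kernel_int_reflect)

lemma right_RL_kernel_int_derivative_reflect:
  "(right_RL_kernel_int \<gamma> d' f has_real_derivative D) (at x within {c..d}) \<longleftrightarrow>
   (left_RL_kernel_int \<gamma> (-d') (\<lambda>t. f (-t)) has_real_derivative - D) (at (-x) within {-d..-c})"
  unfolding right_RL_kernel_int_reflect' has_real_derivative_reflect by (rule refl)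

lemma right_RL_differentiable_reflect:
  "right_RL_differentiable \<gamma> c d f x \<longleftrightarrow> left_RL_differentiable \<gamma> (-d) (-c) (\<lambda>t. f (-t)) (-x)"
  unfolding right_RL_differentiable_iff left_RL_differentiable_iff right_RL_kernel_int_derivative_reflect
  by (metis minus_minus)

text \<open>The minus sign in \<open>right_RL\<close> cancels that of the chain rule.
  Differentiability is assumed because otherwise both sides are arbitrary choices made by
  \<open>vector_derivative\<close>.\<close>

lemma right_RL_reflect:
  assumes "c < d" "x \<in> {c..d}" "right_RL_differentiable \<gamma> c d f x"
  shows "right_RL \<gamma> c d f x = left_RL \<gamma> (-d) (-c) (\<lambda>t. f (-t)) (-x)"
proof -
  obtain D where D: "(right_RL_kernel_int \<gamma> d f has_real_derivative D) (at x within {c..d})"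
    using assms(3) right_RL_differentiable_iff by blast
  with right_RL_eqI[OF assms(1,2) D] left_RL_eqI[of "-d" "-c" "-x" \<gamma> "\<lambda>t. f (-t)" "-D"] assms(1,2)
  show ?thesis by (simp add: right_RL_kernel_int_derivative_reflect)
qed

lemma right_RL_ext_reflect:
  assumes "c < d" and diff: "\<And>x. x \<in> {c..<d} \<Longrightarrow> right_RL_differentiable \<gamma> c d f x" and x: "x \<in> {c..d}"
  shows "right_RL_ext \<gamma> c d f x = left_RL_ext \<gamma> (-d) (-c) (\<lambda>t. f (-t)) (-x)"
proof (cases "x = d")
  case True
  have "\<forall>\<^sub>F x in at_left d. right_RL \<gamma> c d f x = left_RL \<gamma> (-d) (-c) (\<lambda>t. f (-t)) (-x)"
    using assms by (auto simp: eventually_at_left intro!: exI[of _ c] right_RL_reflect)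
  \<comment> \<open>Having this for every \<open>l\<close> identifies the two \<open>Lim\<close>
    terms, which are definite descriptions, without knowing that a limit exists.\<close>
  then have "(right_RL \<gamma> c d f \<longlongrightarrow> l) (at_left d) \<longleftrightarrow>
      (left_RL \<gamma> (-d) (-c) (\<lambda>t. f (-t)) \<longlongrightarrow> l) (at_right (-d))" for l
    using filterlim_cong[OF refl refl]
    by (subst filterlim_cong[OF refl refl]) (auto simp: at_left_minus[of d] filterlim_filtermap)
  then show ?thesis
    unfolding right_RL_ext_def left_RL_ext_def Topological_Spaces.Lim_def using True by simp
next
  case False
  then show ?thesis
    using right_RL_reflect[OF assms(1) x diff] x by (simp add: right_RL_ext_def left_RL_ext_def)
qed

lemma has_continuous_right_RL_reflect:
  assumes "c < d"
  shows "has_continuous_right_RL \<gamma> c d f \<longleftrightarrow> has_continuous_left_RL \<gamma> (-d) (-c) (\<lambda>t. f (-t))"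
proof -
  let ?G = "left_RL_ext \<gamma> (-d) (-c) (\<lambda>t. f (-t))"
  have "(\<forall>x\<in>{c..<d}. right_RL_differentiable \<gamma> c d f x) \<longleftrightarrow>
      (\<forall>x\<in>uminus ` {-d<..-c}. right_RL_differentiable \<gamma> c d f x)"
    by simp
  also have "\<dots> \<longleftrightarrow> (\<forall>x\<in>{-d<..-c}. left_RL_differentiable \<gamma> (-d) (-c) (\<lambda>t. f (-t)) x)"
    unfolding right_RL_differentiable_reflect ball_simps by simp
  finally have diff: "(\<forall>x\<in>{c..<d}. right_RL_differentiable \<gamma> c d f x) \<longleftrightarrow> \<dots>" .
  have neg: "continuous_on S uminus" for S :: "real set"
    by (intro continuous_intros)
  have "continuous_on {c..d} (\<lambda>x. ?G (-x)) \<longleftrightarrow> continuous_on {-d..-c} ?G"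
    using continuous_on_compose2[of "{-d..-c}" ?G "{c..d}" uminus]
      continuous_on_compose2[of "{c..d}" "\<lambda>x. ?G (-x)" "{-d..-c}" uminus]
    by (auto simp: neg)
  moreover have "continuous_on {c..d} (right_RL_ext \<gamma> c d f) \<longleftrightarrow> continuous_on {c..d} (\<lambda>x. ?G (-x))"
    if "\<forall>x\<in>{c..<d}. right_RL_differentiable \<gamma> c d f x"
    using that right_RL_ext_reflect[OF assms] by (intro continuous_on_cong) auto
  ultimately show ?thesis
    unfolding has_continuous_right_RL_def has_continuous_left_RL_def using diff by blast
qed

lemma continuous_right_RL_add_scaled:
  assumes cd: "c < d" and \<gamma>: "0 < \<gamma>" "\<gamma> < 1"
    and cont: "continuous_on {c..d} f" "continuous_on {c..d} h"
    and f: "has_continuous_right_RL \<gamma> c d f" and h: "has_continuous_right_RL \<gamma> c d h"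
  shows has_continuous_right_RL_add_scaled: "has_continuous_right_RL \<gamma> c d (\<lambda>x. f x + r * h x)"
    and right_RL_ext_add_scaled: "x \<in> {c..d} \<Longrightarrow>
      right_RL_ext \<gamma> c d (\<lambda>x. f x + r * h x) x = right_RL_ext \<gamma> c d f x + r * right_RL_ext \<gamma> c d h x"
proof -
  have cont': "continuous_on {-d..-c} (\<lambda>t. f (-t))" "continuous_on {-d..-c} (\<lambda>t. h (-t))"
    by (auto intro!: continuous_intros continuous_on_compose2[OF cont(1)] continuous_on_compose2[OF cont(2)])
  have cd': "-d < -c" using cd by simp
  note L = continuous_left_RL_add_scaled[OF cd' \<gamma> cont' f[unfolded has_continuous_right_RL_reflect[OF cd]]
    h[unfolded has_continuous_right_RL_reflect[OF cd]], where r = r]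
  show s: "has_continuous_right_RL \<gamma> c d (\<lambda>x. f x + r * h x)"
    using L(1) by (simp add: has_continuous_right_RL_reflect[OF cd])
  have "right_RL_ext \<gamma> c d k x = left_RL_ext \<gamma> (-d) (-c) (\<lambda>t. k (-t)) (-x)"
    if "has_continuous_right_RL \<gamma> c d k" "x \<in> {c..d}" for k x
    using that right_RL_ext_reflect[OF cd] unfolding has_continuous_right_RL_def by blast
  with L(2)[of "-x"] s f h show "x \<in> {c..d} \<Longrightarrow>
      right_RL_ext \<gamma> c d (\<lambda>x. f x + r * h x) x = right_RL_ext \<gamma> c d f x + r * right_RL_ext \<gamma> c d h x"
    by simp
qed

lemma right_RL_kernel_int_add_scaled_derivative:
  assumes \<gamma>: "0 < \<gamma>" "\<gamma> < 1" and cont: "continuous_on {c..d} f" "continuous_on {c..d} h"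
    and x: "x \<in> {c..d}"
    and D: "(right_RL_kernel_int \<gamma> d f has_real_derivative D) (at x within {c..d})"
    and E: "(right_RL_kernel_int \<gamma> d h has_real_derivative E) (at x within {c..d})"
  shows "(right_RL_kernel_int \<gamma> d (\<lambda>t. f t + r * h t) has_real_derivative D + r * E) (at x within {c..d})"
proof -
  have cont': "continuous_on {-d..-c} (\<lambda>t. f (-t))" "continuous_on {-d..-c} (\<lambda>t. h (-t))"
    by (auto intro!: continuous_intros continuous_on_compose2[OF cont(1)] continuous_on_compose2[OF cont(2)])
  show ?thesis
    using left_RL_kernel_int_add_scaled_derivative[OF \<gamma> cont', of "-x" "-D" "-E" r] x D E
    by (simp add: right_RL_kernel_int_derivative_reflect algebra_simps)
qed

section \<open>Test functions and change of base point\<close>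

text \<open>The derivative \<phi> is an argument of its own because the transformed first variation
  is an integral against it. Since both functions live on the whole line and vanish outside the open
  interval, a test function for a subinterval is also one for any larger interval.\<close>

definition test_fun :: "real \<Rightarrow> real \<Rightarrow> (real \<Rightarrow> real) \<Rightarrow> (real \<Rightarrow> real) \<Rightarrow> bool" where
  "test_fun p q \<eta> \<phi> \<longleftrightarrow>
     continuous_on UNIV \<phi> \<and> (\<forall>t. (\<eta> has_real_derivative \<phi> t) (at t)) \<and>
     (\<forall>t. t \<notin> {p<..<q} \<longrightarrow> \<eta> t = 0 \<and> \<phi> t = 0)"

lemma test_fun_continuous: "test_fun p q \<eta> \<phi> \<Longrightarrow> continuous_on S \<eta>"
  unfolding test_fun_def by (meson DERIV_continuous_on DERIV_subset UNIV_I subset_UNIV)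

lemma test_fun_mono: "test_fun p q \<eta> \<phi> \<Longrightarrow> p' \<le> p \<Longrightarrow> q \<le> q' \<Longrightarrow> test_fun p' q' \<eta> \<phi>"
  unfolding test_fun_def by fastforce

lemma test_fun_scale: "test_fun p q \<eta> \<phi> \<Longrightarrow> test_fun p q (\<lambda>t. r * \<eta> t) (\<lambda>t. r * \<phi> t)"
  unfolding test_fun_def by (auto intro!: continuous_intros DERIV_cmult)

lemma test_fun_reflect:
  assumes "test_fun p q \<eta> \<phi>"
  shows "test_fun (-q) (-p) (\<lambda>t. \<eta> (-t)) (\<lambda>t. - \<phi> (-t))"
proof -
  have "((\<lambda>t. \<eta> (-t)) has_real_derivative - \<phi> (-t)) (at t)" for t
    using assms DERIV_chain2[of \<eta> "\<phi> (-t)" uminus t "-1" UNIV]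
    unfolding test_fun_def by (simp add: DERIV_minus[OF DERIV_ident])
  moreover have "continuous_on UNIV (\<lambda>t. - \<phi> (-t))"
    using assms unfolding test_fun_def
    by (auto intro!: continuous_on_minus continuous_on_compose2[of UNIV \<phi> UNIV uminus] simp: continuous_on_minus[OF continuous_on_id'])
  ultimately show ?thesis
    using assms unfolding test_fun_def by auto
qed

text \<open>By the Caputo form the derivative is an Abel integral of a continuous function, hence
  continuous up to the base point. Test functions are therefore admissible whichever fractional
  derivatives are present.\<close>

lemma left_RL_test_fun:
  assumes \<gamma>: "0 < \<gamma>" "\<gamma> < 1" and cd: "c < d" and test: "test_fun c d \<eta> \<phi>"
  shows left_RL_ext_test_fun: "x \<in> {c..d} \<Longrightarrow>
      left_RL_ext \<gamma> c d \<eta> x = 1 / Gamma (1 - \<gamma>) * left_RL_kernel_int \<gamma> c \<phi> x"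
    and has_continuous_left_RL_test_fun: "has_continuous_left_RL \<gamma> c d \<eta>"
proof -
  let ?h = "\<lambda>x. 1 / Gamma (1 - \<gamma>) * left_RL_kernel_int \<gamma> c \<phi> x"
  have D: "(left_RL_kernel_int \<gamma> c \<eta> has_real_derivative left_RL_kernel_int \<gamma> c \<phi> x) (at x within {c..d})"
    if "x \<in> {c..d}" for x
    using test that by (intro left_RL_kernel_int_has_derivative \<gamma>) (auto simp: test_fun_def)
  have h: "continuous_on {c..d} ?h"
    using test by (intro continuous_intros continuous_on_left_RL_kernel_int \<gamma>) (auto simp: test_fun_def)
  show ext: "x \<in> {c..d} \<Longrightarrow> left_RL_ext \<gamma> c d \<eta> x = ?h x" for x
    by (rule left_RL_ext_eqI[OF cd _ h]) (use left_RL_eqI[OF cd _ D] in auto)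
  show "has_continuous_left_RL \<gamma> c d \<eta>"
    unfolding has_continuous_left_RL_def left_RL_differentiable_iff
  proof (intro conjI ballI)
    show "continuous_on {c..d} (left_RL_ext \<gamma> c d \<eta>)"
      using continuous_on_cong[THEN iffD2, OF refl ext h] by blast
    fix x assume "x \<in> {c<..d}"
    with D[of x] show "\<exists>D. (left_RL_kernel_int \<gamma> c \<eta> has_real_derivative D) (at x within {c..d})"
      by auto
  qed
qed

lemma right_RL_test_fun:
  assumes \<gamma>: "0 < \<gamma>" "\<gamma> < 1" and cd: "c < d" and test: "test_fun c d \<eta> \<phi>"
  shows right_RL_ext_test_fun: "x \<in> {c..d} \<Longrightarrow>
      right_RL_ext \<gamma> c d \<eta> x = - 1 / Gamma (1 - \<gamma>) * right_RL_kernel_int \<gamma> d \<phi> x"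
    and has_continuous_right_RL_test_fun: "has_continuous_right_RL \<gamma> c d \<eta>"
proof -
  have cd': "-d < -c" using cd by simp
  note L = left_RL_test_fun[OF \<gamma> cd' test_fun_reflect[OF test]]
  show s: "has_continuous_right_RL \<gamma> c d \<eta>"
    using L(2) by (simp add: has_continuous_right_RL_reflect[OF cd])
  have "right_RL_ext \<gamma> c d \<eta> x = left_RL_ext \<gamma> (-d) (-c) (\<lambda>t. \<eta> (-t)) (-x)" if "x \<in> {c..d}" for x
    using that right_RL_ext_reflect[OF cd] s unfolding has_continuous_right_RL_def by blast
  with L(1)[of "-x"] show "x \<in> {c..d} \<Longrightarrow>
      right_RL_ext \<gamma> c d \<eta> x = - 1 / Gamma (1 - \<gamma>) * right_RL_kernel_int \<gamma> d \<phi> x"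
    by (simp add: right_RL_kernel_int_reflect left_RL_kernel_int_def)
qed

section \<open>Moving the base point of a kernel integral\<close>

lemma left_RL_kernel_int_split:
  fixes f :: "real \<Rightarrow> real"
  assumes \<gamma>: "0 < \<gamma>" "\<gamma> < 1" and "c \<le> A" "A \<le> x" and f: "continuous_on {c..x} f"
  shows "left_RL_kernel_int \<gamma> c f x = integral {c..A} (\<lambda>t. (x - t) powr (-\<gamma>) * f t) + left_RL_kernel_int \<gamma> A f x"
  unfolding left_RL_kernel_int_def
  using assms
  by (intro Henstock_Kurzweil_Integration.integral_combine[symmetric] left_RL_kernel_integrable) auto

text \<open>The point \<open>x\<close> lies beyond the range of integration, so the kernel is smooth
  in \<open>x\<close> and may be differentiated under the integral. The midpoint \<open>m\<close>
  keeps the parameter at a positive distance from \<open>A\<close>.\<close>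

lemma left_RL_kernel_int_tail_differentiable:
  fixes f :: "real \<Rightarrow> real"
  assumes Ax: "A < x" and f: "continuous_on {c..A} f"
  shows "(\<lambda>x. integral {c..A} (\<lambda>t. (x - t) powr (-\<gamma>) * f t)) field_differentiable (at x)"
proof -
  define m where "m = (A + x) / 2"
  have m: "A < m" "m < x" using Ax by (auto simp: m_def)
  have "((\<lambda>x. integral (cbox c A) (\<lambda>t. (x - t) powr (-\<gamma>) * f t)) has_field_derivative
      integral (cbox c A) (\<lambda>t. -\<gamma> * (x - t) powr (-\<gamma> - 1) * f t)) (at x within {m<..})"
  proof (rule leibniz_rule_field_derivative)
    show "continuous_on ({m<..} \<times> cbox c A) (\<lambda>(x, t). -\<gamma> * (x - t) powr (-\<gamma> - 1) * f t)"
      unfolding case_prod_unfold using m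
      by (intro continuous_intros continuous_on_compose2[OF f]) auto
    show "(\<lambda>t. (x - t) powr (-\<gamma>) * f t) integrable_on cbox c A" if "x \<in> {m<..}" for x
      using m that f by (auto intro!: integrable_continuous_real continuous_intros)
    show "((\<lambda>x. (x - t) powr (-\<gamma>) * f t) has_field_derivative -\<gamma> * (x - t) powr (-\<gamma> - 1) * f t)
        (at x within {m<..})" if "x \<in> {m<..}" "t \<in> cbox c A" for x t
      using m that by (auto intro!: derivative_eq_intros)
  qed (use m in auto)
  then show ?thesis
    using m by (auto simp: field_differentiable_def at_within_open[of x "{m<..}"])
qed

text \<open>The two kernel integrals differ by the smooth tail. This is how regularity with the base
  \<open>a\<close> or \<open>b\<close> yields the derivatives with the bases \<open>A\<close> and
  \<open>B\<close>; the inequality \<open>A < x\<close> is strict because the tail may be singular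
  at \<open>A\<close>.\<close>

lemma left_RL_kernel_int_base_change:
  assumes \<gamma>: "0 < \<gamma>" "\<gamma> < 1" and x: "c \<le> A" "A < x" "x < d" and f: "continuous_on {c..d} f"
    and diff: "left_RL_differentiable \<gamma> c d f x"
  shows "\<exists>D. (left_RL_kernel_int \<gamma> A f has_real_derivative D) (at x)"
proof -
  have "\<exists>D. (left_RL_kernel_int \<gamma> c f has_real_derivative D) (at x)"
    using diff x unfolding left_RL_differentiable_iff by (simp add: at_within_Icc_at)
  then obtain D where D: "(left_RL_kernel_int \<gamma> c f has_real_derivative D) (at x)" ..
  obtain E where E: "((\<lambda>x. integral {c..A} (\<lambda>t. (x - t) powr (-\<gamma>) * f t)) has_real_derivative E) (at x)"
    using left_RL_kernel_int_tail_differentiable[of A x c f \<gamma>] x continuous_on_subset[OF f]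
    by (auto simp: field_differentiable_def)
  have "(left_RL_kernel_int \<gamma> A f has_real_derivative D - E) (at x)"
  proof (rule has_field_derivative_transform_within_open[where S = "{A<..<d}"])
    show "((\<lambda>x. left_RL_kernel_int \<gamma> c f x - integral {c..A} (\<lambda>t. (x - t) powr (-\<gamma>) * f t))
        has_real_derivative D - E) (at x)"
      by (rule DERIV_diff[OF D E])
    show "left_RL_kernel_int \<gamma> c f z - integral {c..A} (\<lambda>t. (z - t) powr (-\<gamma>) * f t) = left_RL_kernel_int \<gamma> A f z"
      if "z \<in> {A<..<d}" for z
      using left_RL_kernel_int_split[OF \<gamma>, of c A z f] that x continuous_on_subset[OF f, of "{c..z}"] by auto
  qed (use x in auto)
  then show ?thesis ..
qed

lemma right_RL_kernel_int_base_change: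
  assumes \<gamma>: "0 < \<gamma>" "\<gamma> < 1" and x: "c < x" "x < B" "B \<le> d" and f: "continuous_on {c..d} f"
    and diff: "right_RL_differentiable \<gamma> c d f x"
  shows "\<exists>D. (right_RL_kernel_int \<gamma> B f has_real_derivative D) (at x)"
proof -
  have "continuous_on {-d..-c} (\<lambda>t. f (-t))"
    by (auto intro!: continuous_intros continuous_on_compose2[OF f])
  then obtain D where "(left_RL_kernel_int \<gamma> (-B) (\<lambda>t. f (-t)) has_real_derivative D) (at (-x))"
    using left_RL_kernel_int_base_change[OF \<gamma>, of "-d" "-B" "-x" "-c" "\<lambda>t. f (-t)"] x diff
    by (auto simp: right_RL_differentiable_reflect)
  then have "(left_RL_kernel_int \<gamma> (-B) (\<lambda>t. f (-t)) has_real_derivative D) (at (-x) within {-B..-c})"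
    by (rule has_field_derivative_at_within)
  then have "(right_RL_kernel_int \<gamma> B f has_real_derivative -D) (at x within {c..B})"
    by (simp add: right_RL_kernel_int_derivative_reflect)
  then show ?thesis using x by (auto simp: at_within_Icc_at)
qed

section \<open>Fractional integration by parts\<close>

lemma bounded_on_interval:
  fixes f :: "real \<Rightarrow> real"
  assumes "continuous_on {a..b} f"
  obtains C where "C \<ge> 0" "\<And>x. x \<in> {a..b} \<Longrightarrow> \<bar>f x\<bar> \<le> C"
proof -
  have "bounded (f ` {a..b})"
    by (intro compact_imp_bounded compact_continuous_image assms compact_Icc)
  then obtain C where "\<forall>x\<in>{a..b}. \<bar>f x\<bar> \<le> C"
    by (auto simp: bounded_iff)
  then show ?thesis by (intro that[of "max C 0"]) force+
qed

text \<open>The kernel is general so that one exchange serves both the constant 1 and the Abel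
  kernels, and the ranges of \<open>x\<close> and \<open>t\<close> are independent so that
  \<open>{A..B}\<close> can be paired with \<open>{a..b}\<close> either way round. The
  \<open>min\<close> and \<open>max\<close> cut the rectangle down to the region where
  \<open>t\<close> is at most \<open>x\<close>.\<close>

lemma convolution_Fubini:
  fixes k f g :: "real \<Rightarrow> real"
  assumes k: "k \<in> borel_measurable borel" "\<And>s. 0 \<le> k s" "set_integrable lborel {0..B - c} k"
    and f: "continuous_on {A..B} f" and g: "continuous_on {c..d} g"
  shows convolution_integrable_fst:
      "(\<lambda>x. f x * integral {c..min x d} (\<lambda>t. k (x - t) * g t)) integrable_on {A..B}"
    and convolution_integrable_snd:
      "(\<lambda>t. g t * integral {max t A..B} (\<lambda>x. k (x - t) * f x)) integrable_on {c..d}"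
    and convolution_integral_swap:
      "integral {A..B} (\<lambda>x. f x * integral {c..min x d} (\<lambda>t. k (x - t) * g t)) =
       integral {c..d} (\<lambda>t. g t * integral {max t A..B} (\<lambda>x. k (x - t) * f x))"
proof -
  \<comment> \<open>Extension by zero turns everything into integrals over the plane. Cutting
    \<open>k\<close> off at 0 encodes the restriction to \<open>t\<close> at most \<open>x\<close>;
    \<open>B - c\<close> is the largest difference \<open>x - t\<close> that occurs.\<close>
  define k0 where "k0 = (\<lambda>s. indicator {0..B - c} s *\<^sub>R k s)"
  define f' where "f' = (\<lambda>x. indicator {A..B} x *\<^sub>R f x)"
  define g' where "g' = (\<lambda>x. indicator {c..d} x *\<^sub>R g x)"
  define h where "h = (\<lambda>x t. k0 (x - t) * f' x * g' t)"
  have k0_int: "integrable lborel k0"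
    using k(3) by (simp add: k0_def set_integrable_def)
  have k0[measurable]: "k0 \<in> borel_measurable borel"
    using k(1) by (simp add: k0_def)
  have f'[measurable]: "f' \<in> borel_measurable borel" and g'[measurable]: "g' \<in> borel_measurable borel"
    unfolding f'_def g'_def
    by (rule borel_measurable_continuous_on_indicator[OF _ f] borel_measurable_continuous_on_indicator[OF _ g], simp)+
  obtain Cf where Cf: "Cf \<ge> 0" "\<And>x. \<bar>f' x\<bar> \<le> Cf"
    using bounded_on_interval[OF f] unfolding f'_def by (metis abs_zero indicator_simps scaleR_one scaleR_zero_left)
  obtain Cg where Cg: "Cg \<ge> 0" "\<And>x. \<bar>g' x\<bar> \<le> Cg"
    using bounded_on_interval[OF g] unfolding g'_def by (metis abs_zero indicator_simps scaleR_one scaleR_zero_left)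
  have f'_int: "integrable lborel f'" 
    using borel_integrable_atLeastAtMost'[OF f] by (simp add: f'_def set_integrable_def)
  have k0_nonneg: "0 \<le> k0 s" for s using k(2) by (simp add: k0_def)
  have k0_refl: "integrable lborel (\<lambda>t. k0 (x - t))" for x
    using lborel_integrable_real_affine[OF k0_int, of "-1" x] by simp
  have k0_shift: "integrable lborel (\<lambda>x. k0 (x - t))" for t
    using lborel_integrable_real_affine[OF k0_int, of 1 "-t"] by simp
  have int_g: "integrable lborel (\<lambda>t. k0 (x - t) * g' t)" for x
    by (rule Bochner_Integration.integrable_bound[OF integrable_mult_left[OF k0_refl[of x], of Cg]])
      (use Cg k0_nonneg in \<open>auto simp: abs_mult intro!: AE_I2 mult_mono\<close>)
  have int_f: "integrable lborel (\<lambda>x. k0 (x - t) * f' x)" for t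
    by (rule Bochner_Integration.integrable_bound[OF integrable_mult_left[OF k0_shift[of t], of Cf]])
      (use Cf k0_nonneg in \<open>auto simp: abs_mult intro!: AE_I2 mult_mono\<close>)
  have int_h: "integrable (lborel \<Otimes>\<^sub>M lborel) (case_prod h)"
  proof (rule lborel_pair.Fubini_integrable)
    show "case_prod h \<in> borel_measurable (lborel \<Otimes>\<^sub>M lborel)"
      unfolding h_def by measurable
    show "AE x in lborel. integrable lborel (\<lambda>y. case (x, y) of (x, y) \<Rightarrow> h x y)"
      using integrable_mult_right[OF int_g] by (auto simp: h_def ac_simps)
    \<comment> \<open>With \<open>g'\<close> bounded, translation invariance makes the inner
      integral at most a constant times \<open>f'\<close> in absolute value, so Tonelli's criterion
      holds even though the kernel is unbounded.\<close>
    have "(LINT t|lborel. \<bar>h x t\<bar>) \<le> (LINT s|lborel. k0 s) * Cg * \<bar>f' x\<bar>" for x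
    proof -
      have "(LINT t|lborel. \<bar>h x t\<bar>) \<le> (LINT t|lborel. k0 (x - t) * (Cg * \<bar>f' x\<bar>))"
      proof (rule integral_mono)
        have "integrable lborel (h x)" 
          using integrable_mult_right[OF int_g, of "f' x" x] by (simp add: h_def ac_simps)
        then show "integrable lborel (\<lambda>t. \<bar>h x t\<bar>)" by simp
        show "integrable lborel (\<lambda>t. k0 (x - t) * (Cg * \<bar>f' x\<bar>))"
          using k0_refl by simp
        show "\<bar>h x t\<bar> \<le> k0 (x - t) * (Cg * \<bar>f' x\<bar>)" for t
          using mult_left_mono[OF mult_right_mono[OF Cg(2), of "\<bar>f' x\<bar>"] k0_nonneg, of "x - t" t] k0_nonneg
          by (simp add: h_def abs_mult mult_ac)
      qed
      also have "\<dots> = (LINT t|lborel. k0 (x - t)) * (Cg * \<bar>f' x\<bar>)" by simp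
      also have "(LINT t|lborel. k0 (x - t)) = (LINT s|lborel. k0 s)"
        using lborel_integral_real_affine[of "-1" k0 x] by simp
      finally show ?thesis by (simp add: mult.assoc)
    qed
    moreover have "(\<lambda>x. LINT t|lborel. \<bar>h x t\<bar>) \<in> borel_measurable lborel"
      unfolding h_def by measurable
    moreover have "(LINT t|lborel. \<bar>h x t\<bar>) \<ge> 0" for x by simp
    ultimately show "integrable lborel (\<lambda>x. LINT y|lborel. norm (case (x, y) of (x, y) \<Rightarrow> h x y))"
      by (intro Bochner_Integration.integrable_bound[OF integrable_mult_right[OF integrable_abs[OF f'_int], of "(LINT s|lborel. k0 s) * Cg"]])
        (auto intro!: AE_I2 intro: order_trans[OF _ abs_ge_self])
  qed
  have inner_g: "(LINT t|lborel. h x t) = indicator {A..B} x *\<^sub>R (f x * integral {c..min x d} (\<lambda>t. k (x - t) * g t))" for x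
  proof (cases "x \<in> {A..B}")
    case True
    have "(\<lambda>t. k0 (x - t) * g' t) = (\<lambda>t. indicator {c..min x d} t *\<^sub>R (k (x - t) * g t))"
      using True by (auto simp: k0_def g'_def indicator_def fun_eq_iff)
    with int_g[of x] set_borel_integral_eq_integral(2)[of "{c..min x d}" "\<lambda>t. k (x - t) * g t"]
    have "(LINT t|lborel. k0 (x - t) * g' t) = integral {c..min x d} (\<lambda>t. k (x - t) * g t)"
      by (simp add: set_integrable_def set_lebesgue_integral_def)
    moreover have "(LINT t|lborel. h x t) = (LINT t|lborel. f x * (k0 (x - t) * g' t))"
      using True by (simp add: h_def f'_def ac_simps)
    ultimately show ?thesis using True by simp
  qed (simp add: h_def f'_def)
  have inner_f: "(LINT x|lborel. h x t) = indicator {c..d} t *\<^sub>R (g t * integral {max t A..B} (\<lambda>x. k (x - t) * f x))" for t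
  proof (cases "t \<in> {c..d}")
    case True
    have "(\<lambda>x. k0 (x - t) * f' x) = (\<lambda>x. indicator {max t A..B} x *\<^sub>R (k (x - t) * f x))"
      using True by (auto simp: k0_def f'_def indicator_def fun_eq_iff)
    with int_f[of t] set_borel_integral_eq_integral(2)[of "{max t A..B}" "\<lambda>x. k (x - t) * f x"]
    have "(LINT x|lborel. k0 (x - t) * f' x) = integral {max t A..B} (\<lambda>x. k (x - t) * f x)"
      by (simp add: set_integrable_def set_lebesgue_integral_def)
    moreover have "(LINT x|lborel. h x t) = (LINT x|lborel. g t * (k0 (x - t) * f' x))"
      using True by (simp add: h_def g'_def ac_simps)
    ultimately show ?thesis using True by simp
  qed (simp add: h_def g'_def)
  have s1: "set_integrable lborel {A..B} (\<lambda>x. f x * integral {c..min x d} (\<lambda>t. k (x - t) * g t))"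
    using lborel_pair.integrable_fst[OF int_h] unfolding inner_g set_integrable_def .
  have s2: "set_integrable lborel {c..d} (\<lambda>t. g t * integral {max t A..B} (\<lambda>x. k (x - t) * f x))"
    using lborel_pair.integrable_snd[OF int_h] unfolding inner_f set_integrable_def .
  show "(\<lambda>x. f x * integral {c..min x d} (\<lambda>t. k (x - t) * g t)) integrable_on {A..B}"
    "(\<lambda>t. g t * integral {max t A..B} (\<lambda>x. k (x - t) * f x)) integrable_on {c..d}"
    by (rule set_borel_integral_eq_integral[OF s1] set_borel_integral_eq_integral[OF s2])+
  show "integral {A..B} (\<lambda>x. f x * integral {c..min x d} (\<lambda>t. k (x - t) * g t)) =
       integral {c..d} (\<lambda>t. g t * integral {max t A..B} (\<lambda>x. k (x - t) * f x))"
    using lborel_pair.Fubini_integral[OF int_h]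
    unfolding inner_f inner_g set_borel_integral_eq_integral(2)[OF s1, symmetric]
      set_borel_integral_eq_integral(2)[OF s2, symmetric] set_lebesgue_integral_def by (rule sym)
qed

text \<open>Gauge integrability alone does not give Lebesgue integrability; for nonnegative
  functions it does, and Borel measurability leads from the completed measure back to
  \<open>lborel\<close>.\<close>

lemma set_integrable_lborel_nonneg:
  fixes k :: "real \<Rightarrow> real"
  assumes "k \<in> borel_measurable borel" "\<And>s. 0 \<le> k s" "k integrable_on {a..b}"
  shows "set_integrable lborel {a..b} k"
proof -
  have "set_integrable lebesgue {a..b} k"
    using assms by (intro nonnegative_absolutely_integrable_1) auto
  then show ?thesis
    using assms(1) unfolding set_integrable_def by (subst (asm) integrable_completion) auto
qed

lemma set_integrable_powr:
  assumes "\<gamma> < 1"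
  shows "set_integrable lborel {0..T} (\<lambda>s::real. s powr (-\<gamma>))"
proof (cases "0 \<le> T")
  case True
  then show ?thesis
    using has_integral_powr_from_0[of "-\<gamma>" T] assms by (intro set_integrable_lborel_nonneg) auto
qed (simp add: set_integrable_def)

text \<open>The test derivative is \<open>w * (Q - C)\<close> on a compact subinterval, with a
  weight \<open>w\<close> that vanishes at its ends so that the extension by zero is continuous.
  Orthogonality then says that the integral of \<open>w * (Q - C)^2\<close> is 0. Continuity of
  \<open>Q\<close> is asked on the open interval only, as the densities may behave badly at its
  ends.\<close>

lemma du_bois_reymond:
  fixes Q :: "real \<Rightarrow> real"
  assumes apq: "a \<le> p" "q \<le> b" and Q: "continuous_on {p<..<q} Q"
    and orth: "\<And>\<eta> \<phi>. test_fun p q \<eta> \<phi> \<Longrightarrow> integral {a..b} (\<lambda>t. \<phi> t * Q t) = 0"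
    and s: "s1 \<in> {p<..<q}" "s2 \<in> {p<..<q}"
  shows "Q s1 = Q s2"
proof -
  \<comment> \<open>Midpoints, so that \<open>{p'..q'}\<close> is compact inside the open interval
    and has \<open>s1\<close> and \<open>s2\<close> in its interior.\<close>
  define p' where "p' = (p + min s1 s2) / 2"
  define q' where "q' = (q + max s1 s2) / 2"
  have pq: "p < p'" "p' < s1" "p' < s2" "s1 < q'" "s2 < q'" "q' < q" "p' < q'"
    using s by (auto simp: p'_def q'_def)
  define w where "w = (\<lambda>t. (t - p') * (q' - t))"
  have Q': "continuous_on {p'..q'} Q" by (rule continuous_on_subset[OF Q]) (use pq in auto)
  have w: "continuous_on S w" for S unfolding w_def by (intro continuous_intros)
  have w_nonneg: "0 \<le> w t" if "t \<in> {p'..q'}" for t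
    using that by (auto simp: w_def)
  have W: "integral {p'..q'} w \<noteq> 0"
    using integral_eq_0_iff[OF w, of p' q'] pq w_nonneg by (auto simp: w_def intro!: bexI[of _ s1])
  \<comment> \<open>The \<open>w\<close>-weighted mean of \<open>Q\<close>: it gives \<phi> integral
    zero, so that the primitive \<eta> returns to 0 at \<open>q'\<close>.\<close>
  define C where "C = integral {p'..q'} (\<lambda>t. w t * Q t) / integral {p'..q'} w"
  \<comment> \<open>Clamping to \<open>{p'..q'}\<close> defines \<phi> on the whole line by one
    continuous formula; outside the interval the clamped weight is 0.\<close>
  define m where "m = (\<lambda>t. max p' (min q' t))"
  define \<phi> where "\<phi> = (\<lambda>t. w (m t) * (Q (m t) - C))"
  have m: "m t \<in> {p'..q'}" for t using pq by (auto simp: m_def)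
  have \<phi>: "continuous_on UNIV \<phi>"
    unfolding \<phi>_def
    by (intro continuous_intros continuous_on_compose2[OF w[of UNIV]] continuous_on_compose2[OF Q'])
       (use m in \<open>auto simp: m_def intro!: continuous_intros\<close>)
  have \<phi>_in: "\<phi> t = w t * (Q t - C)" if "t \<in> {p'..q'}" for t
    using that by (auto simp: \<phi>_def m_def)
  have \<phi>_out: "\<phi> t = 0" if "t \<notin> {p'<..<q'}" for t
    using that pq by (auto simp: \<phi>_def m_def w_def)
  have \<phi>_int: "\<phi> integrable_on {x..y}" for x y
    using \<phi> by (intro integrable_continuous_real) (auto intro: continuous_on_subset)
  have \<phi>_0: "integral {x..y} \<phi> = 0" if "y \<le> p' \<or> q' \<le> x" for x y
  proof -
    have "integral {x..y} \<phi> = integral {x..y} (\<lambda>t. 0)"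
      by (rule integral_cong) (use that \<phi>_out in auto)
    then show ?thesis by simp
  qed
  have wQ: "(\<lambda>t. w t * Q t) integrable_on {p'..q'}" "(\<lambda>t. C * w t) integrable_on {p'..q'}"
    by (intro integrable_continuous_real continuous_intros w Q')+
  have mean: "integral {p'..q'} \<phi> = 0"
  proof -
    have "integral {p'..q'} \<phi> = integral {p'..q'} (\<lambda>t. w t * Q t - C * w t)"
      by (rule integral_cong) (simp add: \<phi>_in algebra_simps)
    also have "\<dots> = integral {p'..q'} (\<lambda>t. w t * Q t) - C * integral {p'..q'} w"
      using wQ by (simp add: Henstock_Kurzweil_Integration.integral_diff)
    finally show ?thesis using W by (simp add: C_def)
  qed
  define \<eta> where "\<eta> = (\<lambda>t. integral {p'..t} \<phi>)"
  have "(\<eta> has_real_derivative \<phi> t) (at t)" for t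
  proof -
    \<comment> \<open>The integral defining \<eta> has an empty range left of \<open>p'\<close>. As
      \<phi> vanishes up to \<open>p'\<close>, the lower limit may be moved to \<open>l\<close>,
      strictly below \<open>t\<close>, and then the fundamental theorem gives a two-sided
      derivative.\<close>
    define l where "l = min t p' - 1"
    have l: "l < t" "l \<le> p'" by (auto simp: l_def)
    have eq: "integral {l..z} \<phi> = \<eta> z" if "z \<in> {l<..}" for z
    proof (cases "p' \<le> z")
      case True
      then show ?thesis
        using Henstock_Kurzweil_Integration.integral_combine[OF l(2) True \<phi>_int] \<phi>_0[of p' l] by (simp add: \<eta>_def)
    qed (simp add: \<eta>_def \<phi>_0)
    have "((\<lambda>z. integral {l..z} \<phi>) has_real_derivative \<phi> t) (at t within {l..t + 1})"
      using l by (intro integral_has_real_derivative continuous_on_subset[OF \<phi>]) auto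
    then have "((\<lambda>z. integral {l..z} \<phi>) has_real_derivative \<phi> t) (at t)"
      using l by (simp add: at_within_Icc_at)
    then show ?thesis
      by (rule has_field_derivative_transform_within_open[of _ _ _ "{l<..}"]) (use l eq in auto)
  qed
  moreover have "\<eta> t = 0" if "t \<notin> {p<..<q}" for t
  proof (cases "t \<le> p'")
    case False
    then have "q' \<le> t" using that pq by auto
    then have "integral {p'..t} \<phi> = integral {p'..q'} \<phi> + integral {q'..t} \<phi>"
      using pq by (intro Henstock_Kurzweil_Integration.integral_combine[symmetric] \<phi>_int) auto
    then show ?thesis using mean \<phi>_0[of t q'] by (simp add: \<eta>_def)
  qed (simp add: \<eta>_def \<phi>_0)
  ultimately have "test_fun p q \<eta> \<phi>"
    using \<phi> \<phi>_out pq unfolding test_fun_def by auto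
  then have "0 = integral {a..b} (\<lambda>t. \<phi> t * Q t)" by (simp add: orth)
  also have "\<dots> = integral {p'..q'} (\<lambda>t. \<phi> t * Q t)"
  proof (rule integral_unique, rule has_integral_on_superset, rule integrable_integral)
    show "(\<lambda>t. \<phi> t * Q t) integrable_on {p'..q'}"
      by (intro integrable_continuous_real continuous_intros continuous_on_subset[OF \<phi>] Q') auto
    show "\<phi> t * Q t = 0" if "t \<notin> {p'..q'}" for t
      using that \<phi>_out[of t] by auto
  qed (use pq apq in auto)
  \<comment> \<open>Subtracting \<open>C * \<phi>\<close> completes the square and costs nothing,
    since \<phi> has integral zero.\<close>
  also have "\<dots> = integral {p'..q'} (\<lambda>t. w t * (Q t - C)\<^sup>2 + C * \<phi> t)"
    by (rule integral_cong) (simp add: \<phi>_in power2_eq_square algebra_simps)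
  also have "\<dots> = integral {p'..q'} (\<lambda>t. w t * (Q t - C)\<^sup>2) + C * integral {p'..q'} \<phi>"
    by (subst Henstock_Kurzweil_Integration.integral_add)
       (auto intro!: integrable_continuous_real continuous_intros w Q' continuous_on_subset[OF \<phi>])
  finally have "integral {p'..q'} (\<lambda>t. w t * (Q t - C)\<^sup>2) = 0" using mean by simp
  then have "\<forall>t\<in>{p'..q'}. w t * (Q t - C)\<^sup>2 = 0"
    using pq w_nonneg by (subst (asm) integral_eq_0_iff) (auto intro!: continuous_intros w Q')
  then have "Q t = C" if "t \<in> {p'<..<q'}" for t
    using that by (force simp: w_def)
  then show ?thesis using pq by auto
qed

lemma stationary_derivative_eq_0:
  fixes Q :: "real \<Rightarrow> real"
  assumes apq: "a \<le> p" "q \<le> b"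
    and orth: "\<And>\<eta> \<phi>. test_fun p q \<eta> \<phi> \<Longrightarrow> integral {a..b} (\<lambda>t. \<phi> t * Q t) = 0"
    and D: "\<And>t. t \<in> {p<..<q} \<Longrightarrow> (Q has_real_derivative D t) (at t)" and t: "t \<in> {p<..<q}"
  shows "D t = 0"
proof -
  have "continuous_on {p<..<q} Q"
    using DERIV_isCont[OF D] by (intro continuous_at_imp_continuous_on ballI)
  then have const: "Q s = Q t" if "s \<in> {p<..<q}" for s
    by (rule du_bois_reymond[OF apq _ orth that t])
  have "((\<lambda>_. Q t) has_real_derivative D t) (at t)"
    by (rule has_field_derivative_transform_within_open[OF D[OF t] open_greaterThanLessThan t const])
  then show ?thesis using DERIV_unique DERIV_const by blast
qed

text \<open>
  Integrating the first variation by parts, so that it acts on the derivative of the test function,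
  gives this density.
\<close>

definition variation_density ::
  "real \<Rightarrow> real \<Rightarrow> real \<Rightarrow> real \<Rightarrow> (real \<Rightarrow> real) \<Rightarrow> (real \<Rightarrow> real) \<Rightarrow> (real \<Rightarrow> real) \<Rightarrow> real \<Rightarrow> real" where
  "variation_density \<alpha> \<beta> A B fy fu fv t =
     integral {max t A..B} fy
     + 1 / Gamma (1 - \<alpha>) * integral {max t A..B} (\<lambda>x. (x - t) powr (-\<alpha>) * fu x)
     - 1 / Gamma (1 - \<beta>) * integral {A..min t B} (\<lambda>x. (t - x) powr (-\<beta>) * fv x)"

text \<open>Each of \<eta> and its two fractional derivatives is a convolution of \<phi> with a
  kernel: the constant 1 for \<eta>, as \<open>\<eta> a = 0\<close>, and Abel kernels by the Caputo
  form. Exchanging the integrals moves the kernels onto \<open>fy\<close>, \<open>fu\<close> and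
  \<open>fv\<close>.\<close>

lemma first_variation_eq:
  assumes aAB: "a \<le> A" "A < B" "B \<le> b" and \<alpha>: "0 < \<alpha>" "\<alpha> < 1" and \<beta>: "0 < \<beta>" "\<beta> < 1"
    and cont: "continuous_on {A..B} fy" "continuous_on {A..B} fu" "continuous_on {A..B} fv"
    and test: "test_fun a b \<eta> \<phi>"
  shows "integral {A..B} (\<lambda>x. fy x * \<eta> x + fu x * left_RL_ext \<alpha> a b \<eta> x + fv x * right_RL_ext \<beta> a b \<eta> x) =
    integral {a..b} (\<lambda>t. \<phi> t * variation_density \<alpha> \<beta> A B fy fu fv t)"
proof -
  let ?cu = "1 / Gamma (1 - \<alpha>)" and ?cv = "1 / Gamma (1 - \<beta>)"
  have ab: "a < b" using aAB by simp
  have \<phi>: "continuous_on {a..b} \<phi>" using test unfolding test_fun_def by (auto intro: continuous_on_subset)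
  have \<eta>: "\<eta> x = integral {a..min x b} (\<lambda>t. 1 * \<phi> t)" if "x \<in> {A..B}" for x
  proof -
    have "(\<phi> has_integral \<eta> x - \<eta> a) {a..x}"
      using test that aAB unfolding test_fun_def
      by (intro fundamental_theorem_of_calculus)
        (auto simp: has_real_derivative_iff_has_vector_derivative[symmetric] intro: has_field_derivative_at_within)
    then show ?thesis using test that aAB unfolding test_fun_def by (auto simp: min_def integral_unique)
  qed
  have left: "left_RL_ext \<alpha> a b \<eta> x = ?cu * integral {a..min x b} (\<lambda>t. (x - t) powr (-\<alpha>) * \<phi> t)"
    if "x \<in> {A..B}" for x
    using that aAB left_RL_ext_test_fun[OF \<alpha> ab test, of x] by (simp add: left_RL_kernel_int_def min_def)
  have right: "right_RL_ext \<beta> a b \<eta> x = - ?cv * integral {max x a..b} (\<lambda>t. (t - x) powr (-\<beta>) * \<phi> t)"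
    if "x \<in> {A..B}" for x
    using that aAB right_RL_ext_test_fun[OF \<beta> ab test, of x] by (simp add: right_RL_kernel_int_def max_absorb1)
  have k1: "set_integrable lborel {0..T} (\<lambda>s. 1::real)" for T :: real
    by (rule set_integrable_lborel_nonneg) auto
  note F1 = convolution_Fubini[where k = "\<lambda>s. 1", OF _ _ k1 cont(1) \<phi>, simplified]
  note F2 = convolution_Fubini[where k = "\<lambda>s. s powr (-\<alpha>)", OF _ _ set_integrable_powr cont(2) \<phi>, simplified, OF \<alpha>(2)]
  \<comment> \<open>The right derivative integrates over arguments larger than \<open>x\<close>, so
    here \<phi> takes the outer place and \<open>fv\<close> the inner one.\<close>
  note F3 = convolution_Fubini[where k = "\<lambda>s. s powr (-\<beta>)", OF _ _ set_integrable_powr \<phi> cont(3), simplified, OF \<beta>(2)]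
  have "integral {A..B} (\<lambda>x. fy x * \<eta> x + fu x * left_RL_ext \<alpha> a b \<eta> x + fv x * right_RL_ext \<beta> a b \<eta> x) =
    integral {A..B} (\<lambda>x. fy x * integral {a..min x b} \<phi>
      + ?cu * (fu x * integral {a..min x b} (\<lambda>t. (x - t) powr (-\<alpha>) * \<phi> t))
      - ?cv * (fv x * integral {max x a..b} (\<lambda>t. (t - x) powr (-\<beta>) * \<phi> t)))"
    by (rule integral_cong) (simp add: \<eta> left right)
  also have "\<dots> = integral {A..B} (\<lambda>x. fy x * integral {a..min x b} \<phi>)
      + ?cu * integral {A..B} (\<lambda>x. fu x * integral {a..min x b} (\<lambda>t. (x - t) powr (-\<alpha>) * \<phi> t))
      - ?cv * integral {A..B} (\<lambda>x. fv x * integral {max x a..b} (\<lambda>t. (t - x) powr (-\<beta>) * \<phi> t))"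
    using F1(1) F2(1) F3(2)
    by (simp only: Henstock_Kurzweil_Integration.integral_add Henstock_Kurzweil_Integration.integral_diff
        integrable_add integrable_on_mult_right Henstock_Kurzweil_Integration.integral_mult_right)
  also have "\<dots> = integral {a..b} (\<lambda>t. \<phi> t * integral {max t A..B} fy)
      + ?cu * integral {a..b} (\<lambda>t. \<phi> t * integral {max t A..B} (\<lambda>x. (x - t) powr (-\<alpha>) * fu x))
      - ?cv * integral {a..b} (\<lambda>t. \<phi> t * integral {A..min t B} (\<lambda>x. (t - x) powr (-\<beta>) * fv x))"
    using F1(3) F2(3) F3(3) by simp
  also have "\<dots> = integral {a..b} (\<lambda>t. \<phi> t * integral {max t A..B} fy
      + ?cu * (\<phi> t * integral {max t A..B} (\<lambda>x. (x - t) powr (-\<alpha>) * fu x))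
      - ?cv * (\<phi> t * integral {A..min t B} (\<lambda>x. (t - x) powr (-\<beta>) * fv x)))"
    using F1(2) F2(2) F3(1)
    by (simp only: Henstock_Kurzweil_Integration.integral_add Henstock_Kurzweil_Integration.integral_diff
        integrable_add integrable_on_mult_right Henstock_Kurzweil_Integration.integral_mult_right)
  also have "\<dots> = integral {a..b} (\<lambda>t. \<phi> t * variation_density \<alpha> \<beta> A B fy fu fv t)"
    by (simp only: variation_density_def algebra_simps)
  finally show ?thesis .
qed

section \<open>The Euler-Lagrange equations of a stationary functional\<close>

lemma vanishes_onI: "(\<And>x. x \<in> {p<..<q} \<Longrightarrow> E x = 0) \<Longrightarrow> vanishes_on p q E"
  unfolding vanishes_on_def by (auto intro!: tendsto_eventually simp: eventually_at_filter)

lemma right_RL_kernel_integrable: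
  fixes f :: "real \<Rightarrow> real"
  assumes "0 < \<gamma>" "\<gamma> < 1" "x \<le> d" "continuous_on {x..d} f"
  shows "(\<lambda>t. (t - x) powr (-\<gamma>) * f t) integrable_on {x..d}"
proof -
  have "continuous_on {-d..-x} (\<lambda>t. f (-t))"
    by (auto intro!: continuous_intros continuous_on_compose2[OF assms(4)])
  from left_RL_kernel_integrable[OF assms(1,2) _ this] assms(3)
  have "(\<lambda>t. (-x - t) powr (-\<gamma>) * f (-t)) integrable_on {-d..-x}" by simp
  then have "(\<lambda>t. (-x - (-t)) powr (-\<gamma>) * f (- (-t))) integrable_on {x..d}"
    by (subst (asm) Henstock_Kurzweil_Integration.integrable_reflect_real[symmetric]) simp
  then show ?thesis by simp
qed

definition first_variation ::
  "real \<Rightarrow> real \<Rightarrow> real \<Rightarrow> real \<Rightarrow> real \<Rightarrow> real \<Rightarrow> (real \<Rightarrow> real) \<Rightarrow> (real \<Rightarrow> real) \<Rightarrow> (real \<Rightarrow> real) \<Rightarrow> (real \<Rightarrow> real) \<Rightarrow> real" where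
  "first_variation \<alpha> \<beta> a b A B fy fu fv \<eta> =
     integral {A..B} (\<lambda>x. fy x * \<eta> x + fu x * left_RL_ext \<alpha> a b \<eta> x + fv x * right_RL_ext \<beta> a b \<eta> x)"

context
  fixes \<alpha> \<beta> a b A B :: real and fy fu fv :: "real \<Rightarrow> real"
  assumes aAB: "a \<le> A" "A < B" "B \<le> b" and \<alpha>: "0 < \<alpha>" "\<alpha> < 1" and \<beta>: "0 < \<beta>" "\<beta> < 1"
    and cont: "continuous_on {a..b} fy" "continuous_on {a..b} fu" "continuous_on {a..b} fv"
    and fu: "\<And>x. x \<in> {a..<b} \<Longrightarrow> right_RL_differentiable \<alpha> a b fu x"
    and fv: "\<And>x. x \<in> {a<..b} \<Longrightarrow> left_RL_differentiable \<beta> a b fv x"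
begin

text \<open>\<open>H\<close> stands for the form that the density takes on \<open>{p<..<q}\<close>
  once its \<open>max\<close> and \<open>min\<close> are resolved, which happens differently on each
  of the three intervals.\<close>

lemma stationary_density_derivative:
  assumes pq: "a \<le> p" "q \<le> b"
    and stat: "\<And>\<eta> \<phi>. test_fun p q \<eta> \<phi> \<Longrightarrow> first_variation \<alpha> \<beta> a b A B fy fu fv \<eta> = 0"
    and D: "\<And>t. t \<in> {p<..<q} \<Longrightarrow> (H has_real_derivative D t) (at t)"
    and H: "\<And>t. t \<in> {p<..<q} \<Longrightarrow> H t = variation_density \<alpha> \<beta> A B fy fu fv t" and x: "x \<in> {p<..<q}"
  shows "D x = 0"
proof (rule stationary_derivative_eq_0[OF pq _ _ x])
  have cont': "continuous_on {A..B} fy" "continuous_on {A..B} fu" "continuous_on {A..B} fv"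
    using aAB cont by (auto intro: continuous_on_subset)
  show "integral {a..b} (\<lambda>t. \<phi> t * variation_density \<alpha> \<beta> A B fy fu fv t) = 0" if "test_fun p q \<eta> \<phi>" for \<eta> \<phi>
    using first_variation_eq[OF aAB \<alpha> \<beta> cont' test_fun_mono[OF that pq]] stat[OF that]
    unfolding first_variation_def by simp
  show "(variation_density \<alpha> \<beta> A B fy fu fv has_real_derivative D t) (at t)" if "t \<in> {p<..<q}" for t
    by (rule has_field_derivative_transform_within_open[OF D[OF that], of "{p<..<q}"]) (use that H in auto)
qed

lemma right_kernel_derivative:
  assumes "a < x" "x < T" "T \<le> b"
  obtains D where "(right_RL_kernel_int \<alpha> T fu has_real_derivative D) (at x)"
    "right_RL_differentiable \<alpha> a T fu x" "right_RL \<alpha> a T fu x = - 1 / Gamma (1 - \<alpha>) * D"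
proof -
  obtain D where D: "(right_RL_kernel_int \<alpha> T fu has_real_derivative D) (at x)"
    using right_RL_kernel_int_base_change[OF \<alpha> assms cont(2) fu] assms by auto
  then have D': "(right_RL_kernel_int \<alpha> T fu has_real_derivative D) (at x within {a..T})"
    by (rule has_field_derivative_at_within)
  from that[OF D] right_RL_eqI[OF _ _ D'] D' assms show ?thesis
    by (auto simp: right_RL_differentiable_iff)
qed

lemma left_kernel_derivative:
  assumes "a \<le> T" "T < x" "x < b"
  obtains D where "(left_RL_kernel_int \<beta> T fv has_real_derivative D) (at x)"
    "left_RL_differentiable \<beta> T b fv x" "left_RL \<beta> T b fv x = 1 / Gamma (1 - \<beta>) * D"
proof -
  obtain D where D: "(left_RL_kernel_int \<beta> T fv has_real_derivative D) (at x)"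
    using left_RL_kernel_int_base_change[OF \<beta> assms cont(3) fv] assms by auto
  then have D': "(left_RL_kernel_int \<beta> T fv has_real_derivative D) (at x within {T..b})"
    by (rule has_field_derivative_at_within)
  from that[OF D] left_RL_eqI[OF _ _ D'] D' assms show ?thesis
    by (auto simp: left_RL_differentiable_iff)
qed

lemma stationary_mid:
  assumes stat: "\<And>\<eta> \<phi>. test_fun A B \<eta> \<phi> \<Longrightarrow> first_variation \<alpha> \<beta> a b A B fy fu fv \<eta> = 0"
  shows "(\<forall>x\<in>{A<..<B}. right_RL_differentiable \<alpha> a B fu x \<and> left_RL_differentiable \<beta> A b fv x) \<and>
    vanishes_on A B (\<lambda>x. fy x + right_RL \<alpha> a B fu x + left_RL \<beta> A b fv x)"
proof -
  let ?H = "\<lambda>t. integral {A..B} fy - integral {A..t} fy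
    + 1 / Gamma (1 - \<alpha>) * right_RL_kernel_int \<alpha> B fu t - 1 / Gamma (1 - \<beta>) * left_RL_kernel_int \<beta> A fv t"
  \<comment> \<open>The negative of the Euler-Lagrange expression; the 0 is the derivative of the
    constant \<open>integral {A..B} fy\<close>.\<close>
  let ?D = "\<lambda>t. 0 - fy t - right_RL \<alpha> a B fu t - left_RL \<beta> A b fv t"
  have *: "right_RL_differentiable \<alpha> a B fu x \<and> left_RL_differentiable \<beta> A b fv x \<and>
      (?H has_real_derivative ?D x) (at x)" if x: "x \<in> {A<..<B}" for x
  proof -
    obtain D where D: "(right_RL_kernel_int \<alpha> B fu has_real_derivative D) (at x)"
        "right_RL_differentiable \<alpha> a B fu x" "right_RL \<alpha> a B fu x = - 1 / Gamma (1 - \<alpha>) * D"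
      by (rule right_kernel_derivative[of x B]) (use x aAB in auto)
    obtain E where E: "(left_RL_kernel_int \<beta> A fv has_real_derivative E) (at x)"
        "left_RL_differentiable \<beta> A b fv x" "left_RL \<beta> A b fv x = 1 / Gamma (1 - \<beta>) * E"
      by (rule left_kernel_derivative[of A x]) (use x aAB in auto)
    have "((\<lambda>t. integral {A..t} fy) has_real_derivative fy x) (at x within {A..B})"
      using x aAB by (intro integral_has_real_derivative continuous_on_subset[OF cont(1)]) auto
    then have "((\<lambda>t. integral {A..t} fy) has_real_derivative fy x) (at x)"
      using x by (simp add: at_within_Icc_at)
    then have "(?H has_real_derivative (0 - fy x + 1 / Gamma (1 - \<alpha>) * D - 1 / Gamma (1 - \<beta>) * E)) (at x)"
      by (intro DERIV_diff DERIV_add DERIV_cmult DERIV_const D E)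
    with D E show ?thesis by simp
  qed
  have H: "?H t = variation_density \<alpha> \<beta> A B fy fu fv t" if "t \<in> {A<..<B}" for t
  proof -
    have "integral {A..t} fy + integral {t..B} fy = integral {A..B} fy"
      using that aAB
      by (intro Henstock_Kurzweil_Integration.integral_combine integrable_continuous_real continuous_on_subset[OF cont(1)]) auto
    with that show ?thesis
      by (simp add: variation_density_def left_RL_kernel_int_def right_RL_kernel_int_def max_absorb1 min_absorb1)
  qed
  have D0: "?D x = 0" if "x \<in> {A<..<B}" for x
    by (rule stationary_density_derivative[where H = ?H and D = ?D, OF aAB(1,3) stat conjunct2[OF conjunct2[OF *]] H that])
  have "vanishes_on A B (\<lambda>x. fy x + right_RL \<alpha> a B fu x + left_RL \<beta> A b fv x)"
    by (rule vanishes_onI) (use D0 in force)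
  with * show ?thesis by blast
qed

text \<open>For \<open>t\<close> below \<open>A\<close> the \<open>fy\<close> term of the density is
  constant and the \<open>fv\<close> term has an empty range. The \<open>fu\<close> term covers
  \<open>{A..B}\<close>, that is \<open>{t..B}\<close> without \<open>{t..A}\<close>, whence the
  difference of two right derivatives.\<close>

lemma stationary_left:
  assumes stat: "\<And>\<eta> \<phi>. test_fun a A \<eta> \<phi> \<Longrightarrow> first_variation \<alpha> \<beta> a b A B fy fu fv \<eta> = 0"
  shows "(\<forall>x\<in>{a<..<A}. right_RL_differentiable \<alpha> a B fu x \<and> right_RL_differentiable \<alpha> a A fu x) \<and>
    vanishes_on a A (\<lambda>x. right_RL \<alpha> a B fu x - right_RL \<alpha> a A fu x)"
proof -
  let ?H = "\<lambda>t. integral {A..B} fy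
    + (1 / Gamma (1 - \<alpha>) * right_RL_kernel_int \<alpha> B fu t - 1 / Gamma (1 - \<alpha>) * right_RL_kernel_int \<alpha> A fu t)"
  let ?D = "\<lambda>t. 0 + (- right_RL \<alpha> a B fu t + right_RL \<alpha> a A fu t)"
  have *: "right_RL_differentiable \<alpha> a B fu x \<and> right_RL_differentiable \<alpha> a A fu x \<and>
      (?H has_real_derivative ?D x) (at x)" if x: "x \<in> {a<..<A}" for x
  proof -
    obtain D where D: "(right_RL_kernel_int \<alpha> B fu has_real_derivative D) (at x)"
        "right_RL_differentiable \<alpha> a B fu x" "right_RL \<alpha> a B fu x = - 1 / Gamma (1 - \<alpha>) * D"
      by (rule right_kernel_derivative[of x B]) (use x aAB in auto)
    obtain E where E: "(right_RL_kernel_int \<alpha> A fu has_real_derivative E) (at x)"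
        "right_RL_differentiable \<alpha> a A fu x" "right_RL \<alpha> a A fu x = - 1 / Gamma (1 - \<alpha>) * E"
      by (rule right_kernel_derivative[of x A]) (use x aAB in auto)
    have "(?H has_real_derivative (0 + (1 / Gamma (1 - \<alpha>) * D - 1 / Gamma (1 - \<alpha>) * E))) (at x)"
      by (intro DERIV_diff DERIV_add DERIV_cmult DERIV_const D E)
    with D E show ?thesis by simp
  qed
  have H: "?H t = variation_density \<alpha> \<beta> A B fy fu fv t" if "t \<in> {a<..<A}" for t
  proof -
    have "integral {t..A} (\<lambda>x. (x - t) powr (-\<alpha>) * fu x) + integral {A..B} (\<lambda>x. (x - t) powr (-\<alpha>) * fu x)
        = integral {t..B} (\<lambda>x. (x - t) powr (-\<alpha>) * fu x)"
      using that aAB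
      by (intro Henstock_Kurzweil_Integration.integral_combine right_RL_kernel_integrable \<alpha> continuous_on_subset[OF cont(2)]) auto
    with that aAB show ?thesis
      by (simp add: variation_density_def right_RL_kernel_int_def max_absorb2 min_absorb1 algebra_simps)
        (simp add: add_divide_distrib[symmetric] diff_divide_distrib[symmetric])
  qed
  have D0: "?D x = 0" if "x \<in> {a<..<A}" for x
    using aAB by (intro stationary_density_derivative[where H = ?H and D = ?D, OF order_refl _ stat conjunct2[OF conjunct2[OF *]] H that]) simp_all
  have "vanishes_on a A (\<lambda>x. right_RL \<alpha> a B fu x - right_RL \<alpha> a A fu x)"
    by (rule vanishes_onI) (use D0 in force)
  with * show ?thesis by blast
qed

text \<open>For \<open>t\<close> above \<open>B\<close> the \<open>fy\<close> and \<open>fu\<close>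
  terms have empty ranges. The \<open>fv\<close> term covers \<open>{A..B}\<close>, that is
  \<open>{A..t}\<close> without \<open>{B..t}\<close>, whence the difference of two left
  derivatives.\<close>

lemma stationary_right:
  assumes stat: "\<And>\<eta> \<phi>. test_fun B b \<eta> \<phi> \<Longrightarrow> first_variation \<alpha> \<beta> a b A B fy fu fv \<eta> = 0"
  shows "(\<forall>x\<in>{B<..<b}. left_RL_differentiable \<beta> A b fv x \<and> left_RL_differentiable \<beta> B b fv x) \<and>
    vanishes_on B b (\<lambda>x. left_RL \<beta> A b fv x - left_RL \<beta> B b fv x)"
proof -
  let ?H = "\<lambda>t. 1 / Gamma (1 - \<beta>) * left_RL_kernel_int \<beta> B fv t - 1 / Gamma (1 - \<beta>) * left_RL_kernel_int \<beta> A fv t"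
  let ?D = "\<lambda>t. left_RL \<beta> B b fv t - left_RL \<beta> A b fv t"
  have *: "left_RL_differentiable \<beta> A b fv x \<and> left_RL_differentiable \<beta> B b fv x \<and>
      (?H has_real_derivative ?D x) (at x)" if x: "x \<in> {B<..<b}" for x
  proof -
    obtain D where D: "(left_RL_kernel_int \<beta> A fv has_real_derivative D) (at x)"
        "left_RL_differentiable \<beta> A b fv x" "left_RL \<beta> A b fv x = 1 / Gamma (1 - \<beta>) * D"
      by (rule left_kernel_derivative[of A x]) (use x aAB in auto)
    obtain E where E: "(left_RL_kernel_int \<beta> B fv has_real_derivative E) (at x)"
        "left_RL_differentiable \<beta> B b fv x" "left_RL \<beta> B b fv x = 1 / Gamma (1 - \<beta>) * E"
      by (rule left_kernel_derivative[of B x]) (use x aAB in auto)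
    have "(?H has_real_derivative (1 / Gamma (1 - \<beta>) * E - 1 / Gamma (1 - \<beta>) * D)) (at x)"
      by (intro DERIV_diff DERIV_cmult D E)
    with D E show ?thesis by simp
  qed
  have H: "?H t = variation_density \<alpha> \<beta> A B fy fu fv t" if "t \<in> {B<..<b}" for t
  proof -
    have *: "integral {A..B} (\<lambda>x. (t - x) powr (-\<beta>) * fv x) + left_RL_kernel_int \<beta> B fv t = left_RL_kernel_int \<beta> A fv t"
      using that aAB by (intro left_RL_kernel_int_split[symmetric] \<beta> continuous_on_subset[OF cont(3)]) auto
    show ?thesis
      using that aAB by (simp add: variation_density_def max_absorb1 min_absorb2 flip: *) (simp add: add_divide_distrib)
  qed
  have D0: "?D x = 0" if "x \<in> {B<..<b}" for x
    using aAB by (intro stationary_density_derivative[where H = ?H and D = ?D, OF _ order_refl stat conjunct2[OF conjunct2[OF *]] H that]) simp_all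
  have "vanishes_on B b (\<lambda>x. left_RL \<beta> A b fv x - left_RL \<beta> B b fv x)"
    by (rule vanishes_onI) (use D0 in force)
  with * show ?thesis by blast
qed

end

section \<open>Differentiation of the perturbed functional\<close>

lemma has_partial_line:
  assumes "has_partial X f e p" "{t. p + t *\<^sub>R e \<in> X} = UNIV"
  shows "((\<lambda>t. f (p + t *\<^sub>R e)) has_real_derivative partial X f e p) (at 0)"
  using assms unfolding has_partial_def partial_def
  by (simp add: vector_derivative_works has_real_derivative_iff_has_vector_derivative)

lemma point_Basis:
  "(0, 1, 0, 0) \<in> (Basis :: point set)" "(0, 0, 1, 0) \<in> (Basis :: point set)" "(0, 0, 0, 1) \<in> (Basis :: point set)"
  by (auto simp: Basis_prod_def zero_prod_def)

lemma lagrangian_has_real_derivatives: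
  assumes f: "C1_partials_on (lagrangian_domain a b) f" and x: "x \<in> {a..b}"
  shows "((\<lambda>t. f (x, t, u, v)) has_real_derivative partial_y a b f (x, y, u, v)) (at y)"
    and "((\<lambda>t. f (x, y, t, v)) has_real_derivative partial_u a b f (x, y, u, v)) (at u)"
    and "((\<lambda>t. f (x, y, u, t)) has_real_derivative partial_v a b f (x, y, u, v)) (at v)"
proof -
  have p: "has_partial (lagrangian_domain a b) f e (x, y, u, v)" if "e \<in> Basis" for e
    using f that x by (auto simp: C1_partials_on_def lagrangian_domain_def)
  note D = has_partial_line[OF p[OF point_Basis(1)]] has_partial_line[OF p[OF point_Basis(2)]] has_partial_line[OF p[OF point_Basis(3)]]
  show "((\<lambda>t. f (x, t, u, v)) has_real_derivative partial_y a b f (x, y, u, v)) (at y)"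
    using D(1) x DERIV_shift[of "\<lambda>t. f (x, t, u, v)" _ 0 y] by (simp add: lagrangian_domain_def partial_y_def add.commute)
  show "((\<lambda>t. f (x, y, t, v)) has_real_derivative partial_u a b f (x, y, u, v)) (at u)"
    using D(2) x DERIV_shift[of "\<lambda>t. f (x, y, t, v)" _ 0 u] by (simp add: lagrangian_domain_def partial_u_def add.commute)
  show "((\<lambda>t. f (x, y, u, t)) has_real_derivative partial_v a b f (x, y, u, v)) (at v)"
    using D(3) x DERIV_shift[of "\<lambda>t. f (x, y, u, t)" _ 0 v] by (simp add: lagrangian_domain_def partial_v_def add.commute)
qed

lemma partials_continuous:
  assumes f: "C1_partials_on (lagrangian_domain a b) f"
  shows "continuous_on ({a..b} \<times> UNIV) (partial_y a b f)" "continuous_on ({a..b} \<times> UNIV) (partial_u a b f)"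
    "continuous_on ({a..b} \<times> UNIV) (partial_v a b f)"
proof -
  show "continuous_on ({a..b} \<times> UNIV) (partial_y a b f)" "continuous_on ({a..b} \<times> UNIV) (partial_u a b f)"
    "continuous_on ({a..b} \<times> UNIV) (partial_v a b f)"
    using f point_Basis unfolding C1_partials_on_def partial_y_def partial_u_def partial_v_def
    by (auto simp flip: lagrangian_domain_def)
qed

text \<open>A bounded linear function instead of a triple of numbers, because its continuity in the
  point is needed in the operator norm for the theorems on partial derivatives and on parameter
  integrals.\<close>

definition yuv_gradient :: "real \<Rightarrow> real \<Rightarrow> (point \<Rightarrow> real) \<Rightarrow> point \<Rightarrow> (real \<times> real \<times> real) \<Rightarrow>\<^sub>L real" where
  "yuv_gradient a b f p = partial_y a b f p *\<^sub>R fst_blinfun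
     + partial_u a b f p *\<^sub>R (fst_blinfun o\<^sub>L snd_blinfun) + partial_v a b f p *\<^sub>R (snd_blinfun o\<^sub>L snd_blinfun)"

lemma yuv_gradient_apply [simp]:
  "yuv_gradient a b f p (h1, h2, h3) = partial_y a b f p * h1 + partial_u a b f p * h2 + partial_v a b f p * h3"
  by (simp add: yuv_gradient_def blinfun.bilinear_simps)

lemma yuv_gradient_continuous:
  "C1_partials_on (lagrangian_domain a b) f \<Longrightarrow> continuous_on ({a..b} \<times> UNIV) (yuv_gradient a b f)"
  unfolding yuv_gradient_def using partials_continuous by (intro continuous_intros) auto

text \<open>The derivative in the second factor is continuous, the one in the first factor is a
  number at a single point. In this form one coordinate after another can be added: \<open>u\<close>
  to \<open>v\<close>, then \<open>y\<close>, and finally \<open>x\<close> relative to its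
  interval.\<close>

lemma has_derivative_prodI:
  fixes g :: "real \<times> 'b::real_normed_vector \<Rightarrow> real"
  assumes fst: "((\<lambda>t. g (t, q)) has_real_derivative d) (at y within X)"
    and snd: "\<And>y q. y \<in> X \<Longrightarrow> ((\<lambda>q. g (y, q)) has_derivative blinfun_apply (G (y, q))) (at q)"
    and G: "continuous_on (X \<times> UNIV) G" and y: "y \<in> X"
  shows "(g has_derivative (\<lambda>h. d * fst h + blinfun_apply (G (y, q)) (snd h))) (at (y, q) within X \<times> UNIV)"
proof -
  have "((\<lambda>(y, q). g (y, q)) has_derivative (\<lambda>(h, k). d * h + blinfun_apply (G (y, q)) k)) (at (y, q) within X \<times> UNIV)"
  proof (rule has_derivative_partialsI[where fx = "\<lambda>h. d * h" and fy = "\<lambda>y q. G (y, q)"])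
    show "((\<lambda>y. g (y, q)) has_derivative (\<lambda>h. d * h)) (at y within X)"
      using fst unfolding has_field_derivative_def .
    show "continuous (at (y, q) within X \<times> UNIV) (\<lambda>(y, q). G (y, q))"
      using G y by (simp add: continuous_on_eq_continuous_within)
  qed (use snd in auto)
  then show ?thesis by (simp add: case_prod_unfold)
qed

lemma lagrangian_has_derivative:
  assumes f: "C1_partials_on (lagrangian_domain a b) f" and x: "x \<in> {a..b}"
  shows "((\<lambda>q. f (x, q)) has_derivative blinfun_apply (yuv_gradient a b f (x, p))) (at p)"
proof -
  obtain y u v where p: "p = (y, u, v)" by (cases p) auto
  note D = lagrangian_has_real_derivatives[OF f x]
  note c = partials_continuous[OF f, THEN continuous_on_compose2]
  have uv: "((\<lambda>q. f (x, y, q)) has_derivative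
      blinfun_apply (partial_u a b f (x, y, q) *\<^sub>R fst_blinfun + partial_v a b f (x, y, q) *\<^sub>R snd_blinfun))
      (at q)" for y q
  proof -
    obtain u v where q: "q = (u, v)" by (cases q) auto
    have D': "((\<lambda>q. f (x, y, q)) has_derivative (\<lambda>h. partial_u a b f (x, y, u, v) * fst h +
        blinfun_apply (partial_v a b f (x, y, u, v) *\<^sub>R id_blinfun) (snd h))) (at (u, v) within UNIV \<times> UNIV)"
    proof (rule has_derivative_prodI[where G = "\<lambda>q. partial_v a b f (x, y, q) *\<^sub>R id_blinfun"])
      show "((\<lambda>v. f (x, y, u, v)) has_derivative blinfun_apply (partial_v a b f (x, y, u, v) *\<^sub>R id_blinfun)) (at v)" for u v
        using D(3) unfolding has_field_derivative_def by (simp add: scaleR_blinfun.rep_eq)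
    qed (use x in \<open>auto intro!: continuous_intros c(3) D(2)\<close>)
    show ?thesis
      unfolding q by (rule has_derivative_eq_rhs[OF D'[unfolded UNIV_Times_UNIV]]) (simp add: blinfun.bilinear_simps fun_eq_iff)
  qed
  have D': "((\<lambda>q. f (x, q)) has_derivative (\<lambda>h. partial_y a b f (x, y, u, v) * fst h +
      blinfun_apply (partial_u a b f (x, y, u, v) *\<^sub>R fst_blinfun + partial_v a b f (x, y, u, v) *\<^sub>R snd_blinfun) (snd h)))
      (at (y, u, v) within UNIV \<times> UNIV)"
    by (rule has_derivative_prodI[where G = "\<lambda>q. partial_u a b f (x, q) *\<^sub>R fst_blinfun + partial_v a b f (x, q) *\<^sub>R snd_blinfun"])
      (use x uv in \<open>auto intro!: continuous_intros c(2,3) D(1)\<close>)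
  show ?thesis
    unfolding p by (rule has_derivative_eq_rhs[OF D'[unfolded UNIV_Times_UNIV]]) (simp add: yuv_gradient_def blinfun.bilinear_simps fun_eq_iff)
qed

text \<open>\<open>C1_partials_on\<close> speaks of continuity of the partial derivatives only;
  joint continuity of \<open>f\<close> itself comes from total differentiability, with the
  derivative in \<open>x\<close> one-sided at the ends.\<close>

lemma lagrangian_continuous:
  assumes f: "C1_partials_on (lagrangian_domain a b) f"
  shows "continuous_on ({a..b} \<times> UNIV) f"
  unfolding continuous_on_eq_continuous_within
proof
  fix z assume "z \<in> {a..b} \<times> (UNIV :: (real \<times> real \<times> real) set)"
  then obtain x q where z: "z = (x, q)" and x: "x \<in> {a..b}" by (cases z) auto
  let ?e = "(1, 0, 0, 0) :: point"
  have "?e \<in> Basis" by (auto simp: Basis_prod_def zero_prod_def)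
  then have "has_partial (lagrangian_domain a b) f ?e (x, q)"
    using f x by (cases q) (auto simp: C1_partials_on_def lagrangian_domain_def)
  then obtain d where d: "((\<lambda>t. f (x + t, q)) has_real_derivative d) (at 0 within {t. x + t \<in> {a..b}})"
    unfolding has_partial_def by (cases q) (auto simp: lagrangian_domain_def real_differentiable_def)
  have "(+) x ` {t. x + t \<in> {a..b}} = {a..b}"
    by (force intro: image_eqI[where x = "t - x" for t])
  with d DERIV_at_within_shift[of "\<lambda>t. f (t, q)" d x 0 "{t. x + t \<in> {a..b}}"]
  have "((\<lambda>t. f (t, q)) has_real_derivative d) (at x within {a..b})" by simp
  from has_derivative_prodI[OF this lagrangian_has_derivative[OF f] yuv_gradient_continuous[OF f] x]
  show "continuous (at z within {a..b} \<times> UNIV) f"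
    unfolding z by (rule has_derivative_continuous)
qed

lemma integral_blinfun_apply:
  "F integrable_on S \<Longrightarrow> blinfun_apply (integral S F) h = integral S (\<lambda>t. blinfun_apply (F t) h)"
  for F :: "'a::euclidean_space \<Rightarrow> 'b::banach \<Rightarrow>\<^sub>L 'c::banach"
  using integral_linear[of F S "\<lambda>L. blinfun_apply L h"] by (simp add: o_def blinfun.bounded_linear_left)

text \<open>Differentiation under the integral in two parameters. It is stated at every
  \<open>e\<close> because the open mapping argument also uses continuity of the functionals away
  from 0.\<close>

lemma perturbed_integral_has_derivative:
  fixes d1 d2 P :: "real \<Rightarrow> real \<times> real \<times> real"
  assumes f: "C1_partials_on (lagrangian_domain a b) f" and AB: "{A..B} \<subseteq> {a..b}"
    and P: "continuous_on {A..B} P" and d1: "continuous_on {A..B} d1" and d2: "continuous_on {A..B} d2"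
  defines "\<Phi> \<equiv> \<lambda>e. integral {A..B} (\<lambda>x. f (x, P x + fst e *\<^sub>R d1 x + snd e *\<^sub>R d2 x))"
    and "\<Gamma> \<equiv> \<lambda>e x. yuv_gradient a b f (x, P x + fst e *\<^sub>R d1 x + snd e *\<^sub>R d2 x)"
  shows "(\<Phi> has_derivative (\<lambda>h. fst h * integral {A..B} (\<lambda>x. blinfun_apply (\<Gamma> e x) (d1 x)) +
    snd h * integral {A..B} (\<lambda>x. blinfun_apply (\<Gamma> e x) (d2 x)))) (at e)"
proof -
  let ?q = "\<lambda>e x. P x + fst e *\<^sub>R d1 x + snd e *\<^sub>R d2 x"
  let ?F = "\<lambda>e x. blinfun_apply (\<Gamma> e x) (d1 x) *\<^sub>R fst_blinfun
    + blinfun_apply (\<Gamma> e x) (d2 x) *\<^sub>R snd_blinfun :: (real \<times> real) \<Rightarrow>\<^sub>L real"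
  have snd_cont: "continuous_on (UNIV \<times> {A..B}) (\<lambda>z. k (snd z))" if "continuous_on {A..B} k"
    for k :: "real \<Rightarrow> real \<times> real \<times> real"
    by (rule continuous_on_compose2[OF that]) (auto intro: continuous_intros)
  have q: "continuous_on (UNIV \<times> {A..B}) (\<lambda>z. (snd z, ?q (fst z) (snd z)))"
    by (intro continuous_intros snd_cont P d1 d2)
  have \<Gamma>: "continuous_on (UNIV \<times> {A..B}) (\<lambda>z. \<Gamma> (fst z) (snd z))"
    unfolding \<Gamma>_def by (rule continuous_on_compose2[OF yuv_gradient_continuous[OF f] q]) (use AB in auto)
  have F: "continuous_on (UNIV \<times> {A..B}) (\<lambda>z. ?F (fst z) (snd z))"
    by (intro continuous_intros \<Gamma> snd_cont d1 d2)
  have slice: "continuous_on {A..B} (\<lambda>x. k (fst (e, x)) (snd (e, x)))"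
    if "continuous_on (UNIV \<times> {A..B}) (\<lambda>z. k (fst z) (snd z))" for k :: "real \<times> real \<Rightarrow> real \<Rightarrow> 'z::topological_space" and e
    by (rule continuous_on_compose2[OF that]) (auto intro!: continuous_on_Pair continuous_on_const continuous_on_id)
  have "((\<lambda>e. integral (cbox A B) (\<lambda>x. f (x, ?q e x))) has_derivative integral (cbox A B) (?F e)) (at e within UNIV)"
  proof (rule leibniz_rule)
    fix e :: "real \<times> real" and x assume "x \<in> cbox A B"
    then have x: "x \<in> {a..b}" using AB by auto
    have "((\<lambda>e. ?q e x) has_derivative (\<lambda>h. fst h *\<^sub>R d1 x + snd h *\<^sub>R d2 x)) (at e)"
      by (auto intro!: derivative_eq_intros)
    from has_derivative_compose[OF this lagrangian_has_derivative[OF f x]]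
    show "((\<lambda>e. f (x, ?q e x)) has_derivative blinfun_apply (?F e x)) (at e within UNIV)"
      by (rule has_derivative_eq_rhs) (simp add: \<Gamma>_def fun_eq_iff blinfun.bilinear_simps mult.commute)
  next
    fix e :: "real \<times> real"
    have "continuous_on (UNIV \<times> {A..B}) (\<lambda>z. f (snd z, ?q (fst z) (snd z)))"
      by (rule continuous_on_compose2[OF lagrangian_continuous[OF f] q]) (use AB in auto)
    from slice[of "\<lambda>e x. f (x, ?q e x)", OF this]
    show "(\<lambda>x. f (x, ?q e x)) integrable_on cbox A B" by (auto intro: integrable_continuous_real)
  qed (use F in \<open>auto simp: case_prod_unfold\<close>)
  moreover have "blinfun_apply (integral {A..B} (?F e)) h = fst h * integral {A..B} (\<lambda>x. blinfun_apply (\<Gamma> e x) (d1 x)) +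
      snd h * integral {A..B} (\<lambda>x. blinfun_apply (\<Gamma> e x) (d2 x))" for h
  proof -
    have \<Gamma>': "continuous_on {A..B} (\<Gamma> e)" using slice[OF \<Gamma>] by simp
    have "?F e integrable_on {A..B}"
      by (intro integrable_continuous_interval continuous_intros \<Gamma>' d1 d2)
    then have "blinfun_apply (integral {A..B} (?F e)) h = integral {A..B} (\<lambda>x. blinfun_apply (?F e x) h)"
      by (rule integral_blinfun_apply)
    also have "\<dots> = integral {A..B} (\<lambda>x. fst h * blinfun_apply (\<Gamma> e x) (d1 x) + snd h * blinfun_apply (\<Gamma> e x) (d2 x))"
      by (simp add: blinfun.bilinear_simps mult.commute)
    also have "\<dots> = fst h * integral {A..B} (\<lambda>x. blinfun_apply (\<Gamma> e x) (d1 x)) +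
      snd h * integral {A..B} (\<lambda>x. blinfun_apply (\<Gamma> e x) (d2 x))"
      by (subst Henstock_Kurzweil_Integration.integral_add)
        (auto intro!: integrable_continuous_real continuous_intros \<Gamma>' d1 d2)
    finally show ?thesis .
  qed
  ultimately show ?thesis unfolding \<Phi>_def by (auto elim!: has_derivative_eq_rhs)
qed

text \<open>Sussmann's open mapping theorem combines continuity with an invertible derivative at the
  one point 0. Openness of the pair yields points on the same level of \<open>\<Psi>\<close> with
  larger and with smaller \<open>\<Phi>\<close>, without parametrizing that level.\<close>

lemma constrained_extremum_gradients_dependent:
  fixes \<Phi> \<Psi> :: "real \<times> real \<Rightarrow> real"
  assumes cont: "continuous_on UNIV \<Phi>" "continuous_on UNIV \<Psi>"
    and \<Phi>: "(\<Phi> has_derivative (\<lambda>h. fst h * j1 + snd h * j2)) (at 0)"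
    and \<Psi>: "(\<Psi> has_derivative (\<lambda>h. fst h * i1 + snd h * i2)) (at 0)"
    and \<delta>: "\<delta> > 0"
    and extr: "(\<forall>e. norm e < \<delta> \<and> \<Psi> e = \<Psi> 0 \<longrightarrow> \<Phi> 0 \<le> \<Phi> e) \<or> (\<forall>e. norm e < \<delta> \<and> \<Psi> e = \<Psi> 0 \<longrightarrow> \<Phi> 0 \<ge> \<Phi> e)"
  shows "j1 * i2 = j2 * i1"
proof (rule ccontr)
  assume "j1 * i2 \<noteq> j2 * i1"
  define det where "det = j1 * i2 - j2 * i1"
  have det: "det \<noteq> 0" using \<open>j1 * i2 \<noteq> j2 * i1\<close> by (simp add: det_def)
  let ?f = "\<lambda>e. (\<Phi> e, \<Psi> e)"
  let ?f' = "\<lambda>h. (fst h * j1 + snd h * j2, fst h * i1 + snd h * i2)"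
  \<comment> \<open>Cramer's rule for the matrix with rows \<open>(j1, j2)\<close> and
    \<open>(i1, i2)\<close>.\<close>
  let ?g' = "\<lambda>z. ((fst z * i2 - snd z * j2) / det, (snd z * j1 - fst z * i1) / det)"
  have "?f 0 \<in> interior (?f ` ball 0 \<delta>)"
  proof (rule sussmann_open_mapping[where S = UNIV and f' = ?f' and g' = ?g'])
    show "(?f has_derivative ?f') (at 0)" by (intro has_derivative_Pair \<Phi> \<Psi>)
    show "bounded_linear ?g'"
      by (intro bounded_linear_Pair bounded_linear_divide bounded_linear_compose[OF bounded_linear_divide]
          bounded_linear_sub bounded_linear_mult_const bounded_linear_fst bounded_linear_snd)
    show "?f' \<circ> ?g' = id"
    proof (rule ext)
      fix z :: "real \<times> real"
      have "(fst z * i2 - snd z * j2) / det * j1 + (snd z * j1 - fst z * i1) / det * j2 = fst z * det / det"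
        "(fst z * i2 - snd z * j2) / det * i1 + (snd z * j1 - fst z * i1) / det * i2 = snd z * det / det"
        unfolding det_def by (simp_all add: add_divide_distrib[symmetric] algebra_simps)
      then show "(?f' \<circ> ?g') z = id z" using det by (simp add: prod_eq_iff)
    qed
  qed (use \<delta> in \<open>auto intro!: continuous_intros cont\<close>)
  then obtain r where r: "r > 0" "ball (?f 0) r \<subseteq> ?f ` ball 0 \<delta>"
    by (meson mem_interior)
  have "\<exists>e. norm e < \<delta> \<and> \<Phi> e = \<Phi> 0 + s \<and> \<Psi> e = \<Psi> 0" if "\<bar>s\<bar> < r" for s
  proof -
    have "(\<Phi> 0 + s, \<Psi> 0) \<in> ball (?f 0) r"
      using that by (simp add: dist_prod_def dist_real_def)
    with r(2) show ?thesis by (force simp: image_iff)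
  qed
  \<comment> \<open>The shift \<open>-r/2\<close> contradicts a minimum, the shift
    \<open>r/2\<close> a maximum.\<close>
  from this[of "r/2"] this[of "-r/2"] r(1) extr show False by force
qed

section \<open>Absent fractional derivatives and values along \<open>y\<close>\<close>

lemma relevant_arguments:
  assumes "f \<in> {L, g}" "x \<in> {a..b}" "left_present a b L g \<longrightarrow> u = u'" "right_present a b L g \<longrightarrow> v = v'"
  shows "f (x, y, u, v) = f (x, y, u', v')"
proof -
  have "f (x, y, u, v) = f (x, y, u', v)"
    using assms unfolding left_present_def by blast
  also have "\<dots> = f (x, y, u', v')"
    using assms unfolding right_present_def by blast
  finally show ?thesis .
qed

lemma relevant_arguments_partials:
  assumes f: "f \<in> {L, g}" and x: "x \<in> {a..b}"
    and "left_present a b L g \<longrightarrow> u = u'" "right_present a b L g \<longrightarrow> v = v'"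
  shows "partial_y a b f (x, y, u, v) = partial_y a b f (x, y, u', v')"
    and "partial_u a b f (x, y, u, v) = partial_u a b f (x, y, u', v')"
    and "partial_v a b f (x, y, u, v) = partial_v a b f (x, y, u', v')"
proof -
  \<comment> \<open>A partial derivative reads \<open>f\<close> along a line, so agreement is needed
    at all shifted arguments.\<close>
  have "f (x, y1, u + s, v + t) = f (x, y1, u' + s, v' + t)" for y1 s t
    using assms by (intro relevant_arguments[OF f x]) auto
  from this[of _ 0 0] this[of _ _ 0] this[of _ 0]
  show "partial_y a b f (x, y, u, v) = partial_y a b f (x, y, u', v')"
    "partial_u a b f (x, y, u, v) = partial_u a b f (x, y, u', v')"
    "partial_v a b f (x, y, u, v) = partial_v a b f (x, y, u', v')"
    unfolding partial_y_def partial_u_def partial_v_def partial_def lagrangian_domain_def by simp_all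
qed

text \<open>
  \<open>state\<close> is \<open>along\<close> without its first component and with 0 in place of the derivatives that are not
  present, so that it is continuous.
\<close>

definition state ::
  "real \<Rightarrow> real \<Rightarrow> real \<Rightarrow> real \<Rightarrow> (point \<Rightarrow> real) \<Rightarrow> (point \<Rightarrow> real) \<Rightarrow> (real \<Rightarrow> real) \<Rightarrow> real \<Rightarrow> real \<times> real \<times> real" where
  "state \<alpha> \<beta> a b L g y x =
     (y x, if left_present a b L g then left_RL_ext \<alpha> a b y x else 0,
      if right_present a b L g then right_RL_ext \<beta> a b y x else 0)"

text \<open>In contrast to \<open>state\<close> there are no defaults: test functions have both
  continuous fractional derivatives in any case.\<close>

definition direction ::
  "real \<Rightarrow> real \<Rightarrow> real \<Rightarrow> real \<Rightarrow> (real \<Rightarrow> real) \<Rightarrow> real \<Rightarrow> real \<times> real \<times> real" where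
  "direction \<alpha> \<beta> a b \<eta> x = (\<eta> x, left_RL_ext \<alpha> a b \<eta> x, right_RL_ext \<beta> a b \<eta> x)"

lemma partials_along_eq:
  assumes f: "f \<in> {L, g}" and x: "x \<in> {a..b}"
  shows "partial_y a b f (along \<alpha> \<beta> a b y x) = partial_y a b f (x, state \<alpha> \<beta> a b L g y x)"
    and "partial_u a b f (along \<alpha> \<beta> a b y x) = partial_u a b f (x, state \<alpha> \<beta> a b L g y x)"
    and "partial_v a b f (along \<alpha> \<beta> a b y x) = partial_v a b f (x, state \<alpha> \<beta> a b L g y x)"
  unfolding along_def state_def by (intro relevant_arguments_partials[OF f x]; simp)+

lemma state_continuous:
  assumes "y \<in> admissible \<alpha> \<beta> a b L g"
  shows "continuous_on {a..b} (state \<alpha> \<beta> a b L g y)"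
proof -
  have "continuous_on {a..b} (\<lambda>x. if left_present a b L g then left_RL_ext \<alpha> a b y x else 0)"
    using assms by (cases "left_present a b L g") (auto simp: admissible_def has_continuous_left_RL_def)
  moreover have "continuous_on {a..b} (\<lambda>x. if right_present a b L g then right_RL_ext \<beta> a b y x else 0)"
    using assms by (cases "right_present a b L g") (auto simp: admissible_def has_continuous_right_RL_def)
  ultimately show ?thesis
    using assms unfolding state_def by (intro continuous_on_Pair) (auto simp: admissible_def)
qed

lemma partials_along_continuous:
  assumes f: "f \<in> {L, g}" "C1_partials_on (lagrangian_domain a b) f" and y: "y \<in> admissible \<alpha> \<beta> a b L g"
  shows "continuous_on {a..b} (\<lambda>x. partial_y a b f (along \<alpha> \<beta> a b y x))"
    and "continuous_on {a..b} (\<lambda>x. partial_u a b f (along \<alpha> \<beta> a b y x))"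
    and "continuous_on {a..b} (\<lambda>x. partial_v a b f (along \<alpha> \<beta> a b y x))"
proof -
  have s: "continuous_on {a..b} (\<lambda>x. (x, state \<alpha> \<beta> a b L g y x))"
    by (intro continuous_intros state_continuous y)
  have "continuous_on {a..b} (\<lambda>x. partial_y a b f (x, state \<alpha> \<beta> a b L g y x))"
    "continuous_on {a..b} (\<lambda>x. partial_u a b f (x, state \<alpha> \<beta> a b L g y x))"
    "continuous_on {a..b} (\<lambda>x. partial_v a b f (x, state \<alpha> \<beta> a b L g y x))"
    by (rule partials_continuous[OF f(2), THEN continuous_on_compose2, OF s]; force)+
  then show "continuous_on {a..b} (\<lambda>x. partial_y a b f (along \<alpha> \<beta> a b y x))"
    "continuous_on {a..b} (\<lambda>x. partial_u a b f (along \<alpha> \<beta> a b y x))"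
    "continuous_on {a..b} (\<lambda>x. partial_v a b f (along \<alpha> \<beta> a b y x))"
    using partials_along_eq[OF f(1)] by (auto elim: continuous_on_eq)
qed

section \<open>Perturbing an admissible function by test functions\<close>

context
  fixes \<alpha> \<beta> a b :: real
  assumes ab: "a < b" and \<alpha>: "0 < \<alpha>" "\<alpha> < 1" and \<beta>: "0 < \<beta>" "\<beta> < 1"
begin

lemma direction_continuous:
  assumes "test_fun a b \<eta> \<phi>"
  shows "continuous_on {a..b} (direction \<alpha> \<beta> a b \<eta>)"
  using has_continuous_left_RL_test_fun[OF \<alpha> ab assms] has_continuous_right_RL_test_fun[OF \<beta> ab assms]
    test_fun_continuous[OF assms]
  unfolding direction_def has_continuous_left_RL_def has_continuous_right_RL_def
  by (intro continuous_on_Pair) auto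

lemma test_fun_admissible:
  assumes "test_fun a b \<eta> \<phi>"
  shows "\<eta> \<in> admissible \<alpha> \<beta> a b L g"
  using has_continuous_left_RL_test_fun[OF \<alpha> ab assms] has_continuous_right_RL_test_fun[OF \<beta> ab assms]
    test_fun_continuous[OF assms]
  unfolding admissible_def by auto

lemma perturbation:
  assumes y: "y \<in> admissible \<alpha> \<beta> a b L g" and \<eta>: "test_fun a b \<eta> \<phi>"
  shows admissible_perturbation: "(\<lambda>x. y x + r * \<eta> x) \<in> admissible \<alpha> \<beta> a b L g"
    and left_RL_ext_perturbation: "left_present a b L g \<Longrightarrow> x \<in> {a..b} \<Longrightarrow>
      left_RL_ext \<alpha> a b (\<lambda>x. y x + r * \<eta> x) x = left_RL_ext \<alpha> a b y x + r * left_RL_ext \<alpha> a b \<eta> x"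
    and right_RL_ext_perturbation: "right_present a b L g \<Longrightarrow> x \<in> {a..b} \<Longrightarrow>
      right_RL_ext \<beta> a b (\<lambda>x. y x + r * \<eta> x) x = right_RL_ext \<beta> a b y x + r * right_RL_ext \<beta> a b \<eta> x"
proof -
  note c = test_fun_continuous[OF \<eta>, of "{a..b}"]
  have y': "continuous_on {a..b} y" using y by (simp add: admissible_def)
  note l = continuous_left_RL_add_scaled[OF ab \<alpha> y' c _ has_continuous_left_RL_test_fun[OF \<alpha> ab \<eta>]]
  note r = continuous_right_RL_add_scaled[OF ab \<beta> y' c _ has_continuous_right_RL_test_fun[OF \<beta> ab \<eta>]]
  show "(\<lambda>x. y x + r * \<eta> x) \<in> admissible \<alpha> \<beta> a b L g"
    using y l(1) r(1) c unfolding admissible_def by (auto intro!: continuous_intros)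
  show "left_present a b L g \<Longrightarrow> x \<in> {a..b} \<Longrightarrow>
      left_RL_ext \<alpha> a b (\<lambda>x. y x + r * \<eta> x) x = left_RL_ext \<alpha> a b y x + r * left_RL_ext \<alpha> a b \<eta> x"
    using y l(2) unfolding admissible_def by blast
  show "right_present a b L g \<Longrightarrow> x \<in> {a..b} \<Longrightarrow>
      right_RL_ext \<beta> a b (\<lambda>x. y x + r * \<eta> x) x = right_RL_ext \<beta> a b y x + r * right_RL_ext \<beta> a b \<eta> x"
    using y r(2) unfolding admissible_def by blast
qed

text \<open>Where a derivative is present, the perturbed argument is affine in \<open>r\<close> and
  \<open>s\<close> by linearity. Where it is absent, the two sides may contain different numbers,
  but \<open>f\<close> does not depend on them.\<close>

lemma value_along_perturbation:
  assumes f: "f \<in> {L, g}" and x: "x \<in> {a..b}" and y: "y \<in> admissible \<alpha> \<beta> a b L g"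
    and \<eta>1: "test_fun a b \<eta>1 \<phi>1" and \<eta>2: "test_fun a b \<eta>2 \<phi>2"
  shows "f (along \<alpha> \<beta> a b (\<lambda>t. y t + r * \<eta>1 t + s * \<eta>2 t) x) =
    f (x, state \<alpha> \<beta> a b L g y x + r *\<^sub>R direction \<alpha> \<beta> a b \<eta>1 x + s *\<^sub>R direction \<alpha> \<beta> a b \<eta>2 x)"
  unfolding along_def state_def direction_def scaleR_Pair add_Pair real_scaleR_def
  using left_RL_ext_perturbation[OF y \<eta>1 _ x, of r] right_RL_ext_perturbation[OF y \<eta>1 _ x, of r]
    left_RL_ext_perturbation[OF admissible_perturbation[OF y \<eta>1] \<eta>2 _ x, of r s]
    right_RL_ext_perturbation[OF admissible_perturbation[OF y \<eta>1] \<eta>2 _ x, of r s]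
  by (intro relevant_arguments[OF f x]) simp_all

lemma perturbed_functional_has_derivative:
  assumes f: "f \<in> {L, g}" "C1_partials_on (lagrangian_domain a b) f" and y: "y \<in> admissible \<alpha> \<beta> a b L g"
    and \<eta>1: "test_fun a b \<eta>1 \<phi>1" and \<eta>2: "test_fun a b \<eta>2 \<phi>2" and AB: "a \<le> A" "B \<le> b"
  defines "\<Phi> \<equiv> \<lambda>e. functional \<alpha> \<beta> a b A B f (\<lambda>t. y t + fst e * \<eta>1 t + snd e * \<eta>2 t)"
    and "V \<equiv> first_variation \<alpha> \<beta> a b A B (\<lambda>x. partial_y a b f (along \<alpha> \<beta> a b y x))
      (\<lambda>x. partial_u a b f (along \<alpha> \<beta> a b y x)) (\<lambda>x. partial_v a b f (along \<alpha> \<beta> a b y x))"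
  shows "continuous_on UNIV \<Phi>" and "(\<Phi> has_derivative (\<lambda>h. fst h * V \<eta>1 + snd h * V \<eta>2)) (at 0)"
proof -
  have AB': "{A..B} \<subseteq> {a..b}" using AB by auto
  let ?P = "state \<alpha> \<beta> a b L g y" and ?d = "direction \<alpha> \<beta> a b"
  have \<Phi>: "\<Phi> = (\<lambda>e. integral {A..B} (\<lambda>x. f (x, ?P x + fst e *\<^sub>R ?d \<eta>1 x + snd e *\<^sub>R ?d \<eta>2 x)))"
    unfolding \<Phi>_def functional_def
    using AB' by (intro ext integral_cong value_along_perturbation[OF f(1) _ y \<eta>1 \<eta>2]) auto
  note D = perturbed_integral_has_derivative[OF f(2) AB' continuous_on_subset[OF state_continuous[OF y] AB']
    continuous_on_subset[OF direction_continuous[OF \<eta>1] AB'] continuous_on_subset[OF direction_continuous[OF \<eta>2] AB'], folded \<Phi>]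
  show "continuous_on UNIV \<Phi>"
    using D has_derivative_continuous by (intro continuous_at_imp_continuous_on) blast
  have V: "V \<eta> = integral {A..B} (\<lambda>x. blinfun_apply (yuv_gradient a b f (x, ?P x)) (?d \<eta> x))" for \<eta>
    unfolding V_def first_variation_def direction_def using AB' partials_along_eq[OF f(1)]
    by (intro integral_cong) (simp add: subset_iff)
  show "(\<Phi> has_derivative (\<lambda>h. fst h * V \<eta>1 + snd h * V \<eta>2)) (at 0)"
    unfolding V using D[of 0] by simp
qed

end

section \<open>Lagrange multipliers\<close>

lemma partial_diff_scaled:
  assumes "has_partial X f e p" "has_partial X g e p" "{t. p + t *\<^sub>R e \<in> X} = UNIV"
  shows "partial X (\<lambda>q. f q - c * g q) e p = partial X f e p - c * partial X g e p"
proof -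
  have "((\<lambda>t. f (p + t *\<^sub>R e) - c * g (p + t *\<^sub>R e)) has_real_derivative
      partial X f e p - c * partial X g e p) (at 0)"
    by (intro DERIV_diff DERIV_cmult has_partial_line assms)
  then show ?thesis
    unfolding partial_def[of X "\<lambda>q. f q - c * g q"] assms(3)
    by (intro vector_derivative_at) (simp add: has_real_derivative_iff_has_vector_derivative)
qed

lemma partials_diff_scaled:
  assumes f: "C1_partials_on (lagrangian_domain a b) f" and g: "C1_partials_on (lagrangian_domain a b) g"
    and p: "fst p \<in> {a..b}"
  shows "partial_y a b (\<lambda>q. f q - c * g q) p = partial_y a b f p - c * partial_y a b g p"
    and "partial_u a b (\<lambda>q. f q - c * g q) p = partial_u a b f p - c * partial_u a b g p"
    and "partial_v a b (\<lambda>q. f q - c * g q) p = partial_v a b f p - c * partial_v a b g p"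
proof -
  have p': "p \<in> lagrangian_domain a b" using p by (cases p) (auto simp: lagrangian_domain_def)
  show "partial_y a b (\<lambda>q. f q - c * g q) p = partial_y a b f p - c * partial_y a b g p"
    "partial_u a b (\<lambda>q. f q - c * g q) p = partial_u a b f p - c * partial_u a b g p"
    "partial_v a b (\<lambda>q. f q - c * g q) p = partial_v a b f p - c * partial_v a b g p"
    unfolding partial_y_def partial_u_def partial_v_def
    by (rule partial_diff_scaled;
        use f g p' point_Basis in \<open>cases p; auto simp: C1_partials_on_def lagrangian_domain_def\<close>)+
qed

lemma left_RL_differentiable_cong:
  assumes "\<And>t. t \<in> {c..d} \<Longrightarrow> f t = h t" "x \<in> {c..d}"
  shows "left_RL_differentiable \<gamma> c d f x \<longleftrightarrow> left_RL_differentiable \<gamma> c d h x"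
proof -
  have "left_RL_kernel_int \<gamma> c f z = left_RL_kernel_int \<gamma> c h z" if "z \<in> {c..d}" for z
    unfolding left_RL_kernel_int_def by (rule integral_cong) (use that assms(1) in auto)
  then have "(left_RL_kernel_int \<gamma> c f has_real_derivative D) (at x within {c..d}) \<longleftrightarrow>
      (left_RL_kernel_int \<gamma> c h has_real_derivative D) (at x within {c..d})" for D
    using assms(2) by (intro has_field_derivative_cong_ev) (auto intro: always_eventually)
  then show ?thesis unfolding left_RL_differentiable_iff by simp
qed

lemma right_RL_differentiable_cong:
  assumes "\<And>t. t \<in> {c..d} \<Longrightarrow> f t = h t" "x \<in> {c..d}"
  shows "right_RL_differentiable \<gamma> c d f x \<longleftrightarrow> right_RL_differentiable \<gamma> c d h x"
  unfolding right_RL_differentiable_reflect using assms by (intro left_RL_differentiable_cong) auto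

lemma left_RL_differentiable_diff_scaled:
  assumes "0 < \<gamma>" "\<gamma> < 1" "continuous_on {c..d} f" "continuous_on {c..d} h" "x \<in> {c..d}"
    and "left_RL_differentiable \<gamma> c d f x" "left_RL_differentiable \<gamma> c d h x"
  shows "left_RL_differentiable \<gamma> c d (\<lambda>t. f t - r * h t) x"
  using left_RL_kernel_int_add_scaled_derivative[OF assms(1-5), of _ _ "-r"] assms(6,7)
  unfolding left_RL_differentiable_iff by auto

lemma right_RL_differentiable_diff_scaled:
  assumes "0 < \<gamma>" "\<gamma> < 1" "continuous_on {c..d} f" "continuous_on {c..d} h" "x \<in> {c..d}"
    and "right_RL_differentiable \<gamma> c d f x" "right_RL_differentiable \<gamma> c d h x"
  shows "right_RL_differentiable \<gamma> c d (\<lambda>t. f t - r * h t) x"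
  using right_RL_kernel_int_add_scaled_derivative[OF assms(1-5), of _ _ "-r"] assms(6,7)
  unfolding right_RL_differentiable_iff by auto

lemma first_variation_diff_scaled:
  assumes ab: "a < b" "a \<le> A" "B \<le> b" and \<alpha>: "0 < \<alpha>" "\<alpha> < 1" and \<beta>: "0 < \<beta>" "\<beta> < 1"
    and f: "continuous_on {a..b} fy" "continuous_on {a..b} fu" "continuous_on {a..b} fv"
    and g: "continuous_on {a..b} gy" "continuous_on {a..b} gu" "continuous_on {a..b} gv"
    and h: "\<And>x. x \<in> {a..b} \<Longrightarrow> hy x = fy x - c * gy x" "\<And>x. x \<in> {a..b} \<Longrightarrow> hu x = fu x - c * gu x"
      "\<And>x. x \<in> {a..b} \<Longrightarrow> hv x = fv x - c * gv x"
    and \<eta>: "test_fun a b \<eta> \<phi>"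
  shows "first_variation \<alpha> \<beta> a b A B hy hu hv \<eta> =
    first_variation \<alpha> \<beta> a b A B fy fu fv \<eta> - c * first_variation \<alpha> \<beta> a b A B gy gu gv \<eta>"
proof -
  let ?I = "\<lambda>ky ku kv x. ky x * \<eta> x + ku x * left_RL_ext \<alpha> a b \<eta> x + kv x * right_RL_ext \<beta> a b \<eta> x"
  have "continuous_on {a..b} (left_RL_ext \<alpha> a b \<eta>)" "continuous_on {a..b} (right_RL_ext \<beta> a b \<eta>)"
    using has_continuous_left_RL_test_fun[OF \<alpha> ab(1) \<eta>] has_continuous_right_RL_test_fun[OF \<beta> ab(1) \<eta>]
    by (auto simp: has_continuous_left_RL_def has_continuous_right_RL_def)
  then have "continuous_on {a..b} (?I ky ku kv)"
    if "continuous_on {a..b} ky" "continuous_on {a..b} ku" "continuous_on {a..b} kv" for ky ku kv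
    using that by (intro continuous_intros test_fun_continuous[OF \<eta>])
  then have int: "?I ky ku kv integrable_on {A..B}"
    if "continuous_on {a..b} ky" "continuous_on {a..b} ku" "continuous_on {a..b} kv" for ky ku kv
    using that ab by (intro integrable_continuous_real) (rule continuous_on_subset[of "{a..b}"], auto)
  have "first_variation \<alpha> \<beta> a b A B hy hu hv \<eta> = integral {A..B} (\<lambda>x. ?I fy fu fv x - c * ?I gy gu gv x)"
    unfolding first_variation_def
  proof (rule integral_cong)
    fix x assume "x \<in> {A..B}"
    then have x: "x \<in> {a..b}" using ab by auto
    show "?I hy hu hv x = ?I fy fu fv x - c * ?I gy gu gv x"
      unfolding h[OF x] by (simp add: algebra_simps)
  qed
  also have "\<dots> = integral {A..B} (?I fy fu fv) - c * integral {A..B} (?I gy gu gv)"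
    using int[OF f] int[OF g] by (subst Henstock_Kurzweil_Integration.integral_diff) (auto intro: integrable_on_mult_right)
  finally show ?thesis unfolding first_variation_def .
qed

text \<open>Homogeneity and the triangle inequality bound the distance from \<open>y\<close> to a
  perturbation by \<open>norm e * (N \<eta>1 + N \<eta>2)\<close>. Thus a local extremum for any
  norm becomes a constrained local extremum in the two parameters.\<close>

lemma extremum_variations_dependent:
  assumes ab: "a < b" "a \<le> A" "B \<le> b" and \<alpha>: "0 < \<alpha>" "\<alpha> < 1" and \<beta>: "0 < \<beta>" "\<beta> < 1"
    and L: "C1_partials_on (lagrangian_domain a b) L" and g: "C1_partials_on (lagrangian_domain a b) g"
    and N: "norm_on a b (admissible \<alpha> \<beta> a b L g) N"
    and extr: "local_minimum N (feasible \<alpha> \<beta> a b A B L g y\<^sub>a y\<^sub>b l) (functional \<alpha> \<beta> a b A B L) y \<or>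
         local_maximum N (feasible \<alpha> \<beta> a b A B L g y\<^sub>a y\<^sub>b l) (functional \<alpha> \<beta> a b A B L) y"
    and \<eta>1: "test_fun a b \<eta>1 \<phi>1" and \<eta>2: "test_fun a b \<eta>2 \<phi>2"
  defines "V \<equiv> \<lambda>f. first_variation \<alpha> \<beta> a b A B (\<lambda>x. partial_y a b f (along \<alpha> \<beta> a b y x))
      (\<lambda>x. partial_u a b f (along \<alpha> \<beta> a b y x)) (\<lambda>x. partial_v a b f (along \<alpha> \<beta> a b y x))"
  shows "V L \<eta>1 * V g \<eta>2 = V L \<eta>2 * V g \<eta>1"
proof -
  let ?S = "feasible \<alpha> \<beta> a b A B L g y\<^sub>a y\<^sub>b l" and ?A = "admissible \<alpha> \<beta> a b L g"
  let ?J = "functional \<alpha> \<beta> a b A B L"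
  define z where "z = (\<lambda>(e :: real \<times> real) t. y t + fst e * \<eta>1 t + snd e * \<eta>2 t)"
  define \<Phi> where "\<Phi> = (\<lambda>f e. functional \<alpha> \<beta> a b A B f (z e))"
  have z0: "z 0 = y" by (simp add: z_def)
  have yS: "y \<in> ?S" using extr by (auto simp: local_minimum_def local_maximum_def)
  then have y: "y \<in> ?A" by (simp add: feasible_def)
  obtain \<delta> where \<delta>: "\<delta> > 0" and opt: "(\<forall>w\<in>?S. N (\<lambda>x. y x - w x) < \<delta> \<longrightarrow> ?J y \<le> ?J w) \<or>
      (\<forall>w\<in>?S. N (\<lambda>x. y x - w x) < \<delta> \<longrightarrow> ?J y \<ge> ?J w)"
    using extr unfolding local_minimum_def local_maximum_def by blast
  have \<eta>A: "\<eta>1 \<in> ?A" "\<eta>2 \<in> ?A"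
    using test_fun_admissible[OF ab(1) \<alpha> \<beta>] \<eta>1 \<eta>2 by auto
  have N_nonneg: "N f \<ge> 0" if "f \<in> ?A" for f
    using N that unfolding norm_on_def by blast
  have z_near: "N (\<lambda>x. y x - z e x) \<le> norm e * (N \<eta>1 + N \<eta>2)" for e
  proof -
    have s: "(\<lambda>x. r * \<eta>1 x) \<in> ?A" "(\<lambda>x. r * \<eta>2 x) \<in> ?A" for r
      using test_fun_admissible[OF ab(1) \<alpha> \<beta> test_fun_scale] \<eta>1 \<eta>2 by auto
    have tri: "\<forall>f\<in>?A. \<forall>h\<in>?A. N (\<lambda>x. f x + h x) \<le> N f + N h"
      using N unfolding norm_on_def by blast
    have "N (\<lambda>x. y x - z e x) = N (\<lambda>x. - fst e * \<eta>1 x + - snd e * \<eta>2 x)"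
      by (rule arg_cong[where f = N]) (simp add: z_def fun_eq_iff)
    also have "\<dots> \<le> N (\<lambda>x. - fst e * \<eta>1 x) + N (\<lambda>x. - snd e * \<eta>2 x)"
      using tri[rule_format, OF s(1)[of "- fst e"] s(2)[of "- snd e"]] .
    also have "\<dots> = \<bar>- fst e\<bar> * N \<eta>1 + \<bar>- snd e\<bar> * N \<eta>2"
      using N \<eta>A unfolding norm_on_def by presburger
    also have "\<dots> \<le> norm e * N \<eta>1 + norm e * N \<eta>2"
      using norm_fst_le[of "fst e" "snd e"] norm_snd_le[of "snd e" "fst e"] N_nonneg \<eta>A
      by (intro add_mono mult_right_mono) auto
    finally show ?thesis by (simp add: algebra_simps)
  qed
  have z_feasible: "z e \<in> ?S" if "\<Phi> g e = \<Phi> g 0" for e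
  proof -
    have "z e \<in> ?A"
      unfolding z_def by (intro admissible_perturbation[OF ab(1) \<alpha> \<beta> _ \<eta>2] admissible_perturbation[OF ab(1) \<alpha> \<beta> y \<eta>1])
    moreover have "z e a = y a" "z e b = y b"
      using \<eta>1 \<eta>2 by (auto simp: z_def test_fun_def)
    ultimately show ?thesis
      using yS that by (simp add: feasible_def \<Phi>_def z0)
  qed
  \<comment> \<open>The added 1 keeps the denominator positive when both test functions
    vanish.\<close>
  define \<epsilon> where "\<epsilon> = \<delta> / (N \<eta>1 + N \<eta>2 + 1)"
  have K: "N \<eta>1 + N \<eta>2 \<ge> 0" using N_nonneg \<eta>A by (simp add: add_nonneg_nonneg)
  have \<epsilon>: "\<epsilon> > 0" using \<delta> K by (simp add: \<epsilon>_def)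
  have close: "N (\<lambda>x. y x - z e x) < \<delta>" if "norm e < \<epsilon>" for e
  proof -
    have "norm e * (N \<eta>1 + N \<eta>2) \<le> norm e * (N \<eta>1 + N \<eta>2 + 1)" by (intro mult_left_mono) auto
    also have "\<dots> < \<delta>" using that K by (simp add: \<epsilon>_def pos_less_divide_eq)
    finally show ?thesis using z_near[of e] by simp
  qed
  note D = perturbed_functional_has_derivative[OF ab(1) \<alpha> \<beta> _ _ y \<eta>1 \<eta>2 ab(2,3), folded z_def]
  show ?thesis
  proof (rule constrained_extremum_gradients_dependent)
    show "continuous_on UNIV (\<Phi> L)" "continuous_on UNIV (\<Phi> g)"
      unfolding \<Phi>_def z_def using D(1)[of L, OF _ L] D(1)[of g, OF _ g] by auto
    show "(\<Phi> L has_derivative (\<lambda>h. fst h * V L \<eta>1 + snd h * V L \<eta>2)) (at 0)"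
      "(\<Phi> g has_derivative (\<lambda>h. fst h * V g \<eta>1 + snd h * V g \<eta>2)) (at 0)"
      unfolding \<Phi>_def z_def V_def using D(2)[of L, OF _ L] D(2)[of g, OF _ g] by auto
    show "(\<forall>e. norm e < \<epsilon> \<and> \<Phi> g e = \<Phi> g 0 \<longrightarrow> \<Phi> L 0 \<le> \<Phi> L e) \<or>
        (\<forall>e. norm e < \<epsilon> \<and> \<Phi> g e = \<Phi> g 0 \<longrightarrow> \<Phi> L 0 \<ge> \<Phi> L e)"
      using opt z_feasible close unfolding \<Phi>_def z0 by blast
  qed (rule \<epsilon>)
qed

theorem theorem10:
  fixes a b A B \<alpha> \<beta> l y\<^sub>a y\<^sub>b :: real
    and L g :: "real \<times> real \<times> real \<times> real \<Rightarrow> real"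
    and y :: "real \<Rightarrow> real"
    and N :: "(real \<Rightarrow> real) \<Rightarrow> real"
  assumes "a \<le> A" and "A < B" and "B \<le> b"
    and "\<alpha> \<in> {0<..<1}" and "\<beta> \<in> {0<..<1}"
    and "C2_partials_on (lagrangian_domain a b) L" and "C2_partials_on (lagrangian_domain a b) g"
    and "left_present a b L g \<longrightarrow> y\<^sub>a = 0" and "right_present a b L g \<longrightarrow> y\<^sub>b = 0"
    and "norm_on a b (admissible \<alpha> \<beta> a b L g) N"
    and "local_minimum N (feasible \<alpha> \<beta> a b A B L g y\<^sub>a y\<^sub>b l) (functional \<alpha> \<beta> a b A B L) y \<or>
         local_maximum N (feasible \<alpha> \<beta> a b A B L g y\<^sub>a y\<^sub>b l) (functional \<alpha> \<beta> a b A B L) y"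
    and "regular_along \<alpha> \<beta> a b L y" and "regular_along \<alpha> \<beta> a b g y"
    and "\<not> extremal \<alpha> \<beta> a b A B g y"
  shows "\<exists>\<mu> :: real.
           (let F = (\<lambda>p. L p - \<mu> * g p)
            in euler_lagrange_mid \<alpha> \<beta> a b A B F y \<and>
               euler_lagrange_left \<alpha> \<beta> a b A B F y \<and>
               euler_lagrange_right \<alpha> \<beta> a b A B F y)"
proof -
  have aAB: "a \<le> A" "A < B" "B \<le> b" and ab: "a < b" and \<alpha>: "0 < \<alpha>" "\<alpha> < 1" and \<beta>: "0 < \<beta>" "\<beta> < 1"
    using assms(1-5) by auto
  have C1: "C1_partials_on (lagrangian_domain a b) L" "C1_partials_on (lagrangian_domain a b) g"
    using assms(6,7) by (auto simp: C2_partials_on_def)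
  have y: "y \<in> admissible \<alpha> \<beta> a b L g"
    using assms(11) by (auto simp: local_minimum_def local_maximum_def feasible_def)
  define fy where "fy = (\<lambda>f x. partial_y a b f (along \<alpha> \<beta> a b y x))"
  define fu where "fu = (\<lambda>f x. partial_u a b f (along \<alpha> \<beta> a b y x))"
  define fv where "fv = (\<lambda>f x. partial_v a b f (along \<alpha> \<beta> a b y x))"
  define V where "V = (\<lambda>f. first_variation \<alpha> \<beta> a b A B (fy f) (fu f) (fv f))"
  have cont_L: "continuous_on {a..b} (fy L)" "continuous_on {a..b} (fu L)" "continuous_on {a..b} (fv L)"
    unfolding fy_def fu_def fv_def by (rule partials_along_continuous[OF _ C1(1) y], simp)+
  have cont_g: "continuous_on {a..b} (fy g)" "continuous_on {a..b} (fu g)" "continuous_on {a..b} (fv g)"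
    unfolding fy_def fu_def fv_def by (rule partials_along_continuous[OF _ C1(2) y], simp)+
  have diff_u: "right_RL_differentiable \<alpha> a b (fu L) x" "right_RL_differentiable \<alpha> a b (fu g) x" if "x \<in> {a..<b}" for x
    using assms(12,13) that unfolding regular_along_def has_continuous_right_RL_def fu_def by auto
  have diff_v: "left_RL_differentiable \<beta> a b (fv L) x" "left_RL_differentiable \<beta> a b (fv g) x" if "x \<in> {a<..b}" for x
    using assms(12,13) that unfolding regular_along_def has_continuous_left_RL_def fv_def by auto
  obtain \<eta> \<phi> where \<eta>: "test_fun A B \<eta> \<phi>" "V g \<eta> \<noteq> 0"
  proof -
    \<comment> \<open>The existence claims within \<open>extremal\<close> follow by change of base
      from the regularity along \<open>y\<close>, so failure to be an extremal can only come from a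
      nonzero first variation.\<close>
    have "extremal \<alpha> \<beta> a b A B g y" if "\<And>\<eta> \<phi>. test_fun A B \<eta> \<phi> \<Longrightarrow> V g \<eta> = 0"
      using stationary_mid[OF aAB \<alpha> \<beta> cont_g diff_u(2) diff_v(2)] that
      unfolding extremal_def euler_lagrange_mid_def Let_def V_def fy_def fu_def fv_def by blast
    then show ?thesis using assms(14) that by blast
  qed
  \<comment> \<open>Chosen so that the first variation of \<open>F\<close> vanishes at \<eta>;
    proportionality of the variations of \<open>L\<close> and \<open>g\<close> carries this to every
    other direction.\<close>
  define \<mu> where "\<mu> = V L \<eta> / V g \<eta>"
  define F where "F = (\<lambda>p. L p - \<mu> * g p)"
  \<comment> \<open>These identities hold over \<open>{a..b}\<close>, where the partial derivatives
    are given; continuity and differentiability are therefore passed on to \<open>F\<close> by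
    congruence on that interval.\<close>
  have F: "fy F x = fy L x - \<mu> * fy g x" "fu F x = fu L x - \<mu> * fu g x" "fv F x = fv L x - \<mu> * fv g x"
    if "x \<in> {a..b}" for x
    unfolding F_def fy_def fu_def fv_def
    by (rule partials_diff_scaled[OF C1], use that in \<open>simp add: along_def\<close>)+
  have "continuous_on {a..b} (\<lambda>x. fy L x - \<mu> * fy g x)" "continuous_on {a..b} (\<lambda>x. fu L x - \<mu> * fu g x)"
    "continuous_on {a..b} (\<lambda>x. fv L x - \<mu> * fv g x)"
    by (intro continuous_intros cont_L cont_g)+
  then have cont_F: "continuous_on {a..b} (fy F)" "continuous_on {a..b} (fu F)" "continuous_on {a..b} (fv F)"
    using F by (auto elim: continuous_on_eq)
  have diff_uF: "right_RL_differentiable \<alpha> a b (fu F) x" if "x \<in> {a..<b}" for x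
    using right_RL_differentiable_diff_scaled[OF \<alpha> cont_L(2) cont_g(2) _ diff_u[OF that], of \<mu>] that
      right_RL_differentiable_cong[of a b "fu F" "\<lambda>t. fu L t - \<mu> * fu g t", OF F(2)] by simp
  have diff_vF: "left_RL_differentiable \<beta> a b (fv F) x" if "x \<in> {a<..b}" for x
    using left_RL_differentiable_diff_scaled[OF \<beta> cont_L(3) cont_g(3) _ diff_v[OF that], of \<mu>] that
      left_RL_differentiable_cong[of a b "fv F" "\<lambda>t. fv L t - \<mu> * fv g t", OF F(3)] by simp
  \<comment> \<open>The subinterval is left open, so that one statement serves
    \<open>{a..A}\<close>, \<open>{A..B}\<close> and \<open>{B..b}\<close>.\<close>
  have stat: "V F \<eta>1 = 0" if "test_fun p q \<eta>1 \<phi>1" "a \<le> p" "q \<le> b" for \<eta>1 \<phi>1 p q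
  proof -
    have \<eta>1: "test_fun a b \<eta>1 \<phi>1" using that by (rule test_fun_mono)
    have "V L \<eta>1 * V g \<eta> = V L \<eta> * V g \<eta>1"
      unfolding V_def fy_def fu_def fv_def
      using aAB by (intro extremum_variations_dependent[OF ab aAB(1,3) \<alpha> \<beta> C1 assms(10,11) \<eta>1 test_fun_mono[OF \<eta>(1)]])
    moreover have "V F \<eta>1 = V L \<eta>1 - \<mu> * V g \<eta>1"
      unfolding V_def by (rule first_variation_diff_scaled[OF ab aAB(1,3) \<alpha> \<beta> cont_L cont_g F \<eta>1])
    ultimately show ?thesis using \<eta>(2) by (simp add: \<mu>_def field_simps)
  qed
  note E = stationary_mid[OF aAB \<alpha> \<beta> cont_F diff_uF diff_vF] stationary_left[OF aAB \<alpha> \<beta> cont_F diff_uF diff_vF]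
    stationary_right[OF aAB \<alpha> \<beta> cont_F diff_uF diff_vF]
  have "euler_lagrange_mid \<alpha> \<beta> a b A B F y" "euler_lagrange_left \<alpha> \<beta> a b A B F y" "euler_lagrange_right \<alpha> \<beta> a b A B F y"
    unfolding euler_lagrange_mid_def euler_lagrange_left_def euler_lagrange_right_def Let_def
    using E stat[of A B] stat[of a A] stat[of B b] aAB unfolding V_def fy_def fu_def fv_def by auto
  then show ?thesis unfolding Let_def F_def by blast
qed

end
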